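(* Let $d\ge1$, let $(M,g)$ be a $d$-dimensional smooth compact Riemannian manifold without boundary, and let $0<\alpha\le1$. Let $p,q\ge2$, $\sigma\in\mathbb{R}$, $\beta\in(0,\infty]$. Suppose there is a constant $C$ such that for all $N\ge10$ and intervals $I=I_N\subset\mathbb{R}$ of length $|I_N|\approx N^{1-\alpha}$ (implicit constants independent of $N$), $$\Big\|\sum_j\nu_j|e^{it\Delta^{\alpha/2}}f_j|^2\Big\|_{L^{p/2}_tL^{q/2}_x(I_N\times M)}\le C\,|I_N|^{\frac2p}N^{\sigma}\|\nu\|_{\ell^\beta}$$ holds for all orthonormal systems $(f_j)_j$ in $L^2(M)$ with $\operatorname{supp}\hat f_j\subset\{k:\lambda_k\le N\}$ and all sequences $\nu=(\nu_j)_j\in\ell^\beta$. Then $$\frac1\beta\ge d-\frac{2d}q-\sigma.$$ If moreover $\frac1p=\frac d2\left(\frac12-\frac1q\right)$, this condition is equivalent to $\frac1\beta\ge\frac4p-\sigma$; and if $d\ge2$ and $\frac1p=\frac{d-1}2\left(\frac12-\frac1q\right)$, it is equivalent to $\frac1\beta\ge\frac{d}{d-1}\cdot\frac4p-\sigma$.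
   Context: $\Delta=-\Delta_g$ is the nonnegative Laplace–Beltrami operator on $M$. $(e_k)_k$ is a fixed orthonormal basis of $L^2(M)$ of eigenfunctions, $\sqrt\Delta\, e_k=\lambda_k e_k$, with $0=\lambda_0<\lambda_1\le\lambda_2\le\dots$ counted with multiplicity. For $f\in L^2(M)$, $\hat f(k)=\langle f,e_k\rangle$, and $e^{it\Delta^{\alpha/2}}f=\sum_k e^{it\lambda_k^\alpha}\hat f(k)e_k$. Mixed norms: $\|F\|_{L^a_tL^b_x(I\times M)}=\big\|\,\|F(t,\cdot)\|_{L^b(M)}\big\|_{L^a(I)}$. $X\approx Y$ means $C^{-1}Y\le X\le CY$ for a positive constant $C$. *)

theory Defs
  imports "HOL-Analysis.Analysis" "HOL-Probability.Essential_Supremum"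
begin

section \<open>Smooth functions on open subsets of Euclidean space\<close>

definition partial :: "'n::finite \<Rightarrow> (real^'n \<Rightarrow> 'b::real_normed_vector) \<Rightarrow> real^'n \<Rightarrow> 'b" where
  "partial i f y = frechet_derivative f (at y) (axis i 1)"

(* Only meant for open S; on such S it depends only on the values of f on S. *)
fun Ck_on :: "nat \<Rightarrow> (real^'n::finite) set \<Rightarrow> (real^'n \<Rightarrow> 'b::real_normed_vector) \<Rightarrow> bool" where
  "Ck_on 0 S f \<longleftrightarrow> continuous_on S f"
| "Ck_on (Suc k) S f \<longleftrightarrow> f differentiable_on S \<and> (\<forall>i. Ck_on k S (partial i f))"

definition smooth_on :: "(real^'n::finite) set \<Rightarrow> (real^'n \<Rightarrow> 'b::real_normed_vector) \<Rightarrow> bool" where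
  "smooth_on S f \<longleftrightarrow> (\<forall>k. Ck_on k S f)"


section \<open>Compact Riemannian manifolds\<close>

(* A chart (U, \<phi>) is a homeomorphism \<phi> from U onto an open subset of R^n; the values of \<phi>
   outside U are irrelevant. Coordinates range over open subsets of R^n, so there is no boundary. *)
type_synonym ('a, 'n) chart = "'a set \<times> ('a \<Rightarrow> real^'n)"

definition chart_inv :: "('a, 'n::finite) chart \<Rightarrow> real^'n \<Rightarrow> 'a" where
  "chart_inv c = inv_into (fst c) (snd c)"

definition chart_range :: "('a, 'n::finite) chart \<Rightarrow> (real^'n) set" where
  "chart_range c = snd c ` fst c"

definition transition :: "('a, 'n::finite) chart \<Rightarrow> ('a, 'n) chart \<Rightarrow> real^'n \<Rightarrow> real^'n" where
  "transition c c' = snd c' \<circ> chart_inv c"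

definition smooth_atlas ::
  "'a::{t2_space, second_countable_topology} set \<Rightarrow> ('a, 'n::finite) chart set \<Rightarrow> bool" where
  "smooth_atlas M A \<longleftrightarrow>
     (\<Union>c\<in>A. fst c) = M \<and>
     (\<forall>c\<in>A. openin (top_of_set M) (fst c) \<and> open (chart_range c) \<and>
        homeomorphism (fst c) (chart_range c) (snd c) (chart_inv c)) \<and>
     (\<forall>c\<in>A. \<forall>c'\<in>A. smooth_on (snd c ` (fst c \<inter> fst c')) (transition c c'))"

(* g c x is the Gram matrix (g_ij) at x of the metric in the coordinates of the chart c. *)
definition riemannian_metric ::
  "('a, 'n::finite) chart set \<Rightarrow> (('a, 'n) chart \<Rightarrow> 'a \<Rightarrow> real^'n^'n) \<Rightarrow> bool" where
  "riemannian_metric A g \<longleftrightarrow>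
     (\<forall>c\<in>A. smooth_on (chart_range c) (\<lambda>y. g c (chart_inv c y))) \<and>
     (\<forall>c\<in>A. \<forall>x\<in>fst c. transpose (g c x) = g c x \<and> (\<forall>v. v \<noteq> 0 \<longrightarrow> v \<bullet> (g c x *v v) > 0)) \<and>
     (\<forall>c\<in>A. \<forall>c'\<in>A. \<forall>x\<in>fst c \<inter> fst c'.
        (let J = jacobian (transition c c') (at (snd c x))
         in g c x = transpose J ** g c' x ** J))"

(* \<mu> is the Riemannian volume: the Borel measure on M with density sqrt (det g) in every chart.
   These conditions determine \<mu> uniquely. *)
definition riemannian_volume ::
  "'a::{t2_space, second_countable_topology} set \<Rightarrow> ('a, 'n::finite) chart set \<Rightarrow>
   (('a, 'n) chart \<Rightarrow> 'a \<Rightarrow> real^'n^'n) \<Rightarrow> 'a measure \<Rightarrow> bool" where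
  "riemannian_volume M A g \<mu> \<longleftrightarrow>
     sets \<mu> = sets (restrict_space borel M) \<and>
     (\<forall>c\<in>A. \<forall>B\<in>sets \<mu>. B \<subseteq> fst c \<longrightarrow>
        emeasure \<mu> B =
          (\<integral>\<^sup>+y\<in>snd c ` B. ennreal (sqrt (det (g c (chart_inv c y)))) \<partial>lborel))"

definition compact_riemannian_manifold ::
  "'a::{t2_space, second_countable_topology} set \<Rightarrow> ('a, 'n::finite) chart set \<Rightarrow>
   (('a, 'n) chart \<Rightarrow> 'a \<Rightarrow> real^'n^'n) \<Rightarrow> 'a measure \<Rightarrow> bool" where
  "compact_riemannian_manifold M A g \<mu> \<longleftrightarrow>
     compact M \<and> smooth_atlas M A \<and> riemannian_metric A g \<and> riemannian_volume M A g \<mu>"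

definition smooth_function :: "('a, 'n::finite) chart set \<Rightarrow> ('a \<Rightarrow> complex) \<Rightarrow> bool" where
  "smooth_function A f \<longleftrightarrow> (\<forall>c\<in>A. smooth_on (chart_range c) (f \<circ> chart_inv c))"

(* The coordinate expression
     (det g)^(-1/2) sum_i d_i (sum_j (det g)^(1/2) g^ij d_j f)
   of the (nonpositive) Laplace-Beltrami operator Delta_g f at x, in the chart c. *)
definition laplace_beltrami ::
  "(('a, 'n::finite) chart \<Rightarrow> 'a \<Rightarrow> real^'n^'n) \<Rightarrow> ('a, 'n) chart \<Rightarrow> ('a \<Rightarrow> complex) \<Rightarrow> 'a \<Rightarrow> complex" where
  "laplace_beltrami g c f x =
     (let G = (\<lambda>y. g c (chart_inv c y));
          w = (\<lambda>y. sqrt (det (G y)))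
      in (1 / w (snd c x)) *\<^sub>R
           (\<Sum>i\<in>UNIV. partial i
              (\<lambda>y. \<Sum>j\<in>UNIV. (w y * matrix_inv (G y) $ i $ j) *\<^sub>R partial j (f \<circ> chart_inv c) y)
              (snd c x)))"

(* Eigenfunction of the nonnegative square root of -Delta_g, with eigenvalue l. *)
definition sqrt_laplace_eigenfunction ::
  "('a, 'n::finite) chart set \<Rightarrow> (('a, 'n) chart \<Rightarrow> 'a \<Rightarrow> real^'n^'n) \<Rightarrow> real \<Rightarrow> ('a \<Rightarrow> complex) \<Rightarrow> bool" where
  "sqrt_laplace_eigenfunction A g l f \<longleftrightarrow>
     0 \<le> l \<and> smooth_function A f \<and>
     (\<forall>c\<in>A. \<forall>x\<in>fst c. - laplace_beltrami g c f x = of_real (l\<^sup>2) * f x)"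


section \<open>The Hilbert space of square integrable functions\<close>

(* Elements of L^2 are represented by functions; statements below only depend on them up to
   null sets. *)
definition L2 :: "'a measure \<Rightarrow> ('a \<Rightarrow> complex) set" where
  "L2 \<mu> = {f \<in> borel_measurable \<mu>. integrable \<mu> (\<lambda>x. (cmod (f x))\<^sup>2)}"

definition L2_inner :: "'a measure \<Rightarrow> ('a \<Rightarrow> complex) \<Rightarrow> ('a \<Rightarrow> complex) \<Rightarrow> complex" where
  "L2_inner \<mu> f h = (\<integral>x. f x * cnj (h x) \<partial>\<mu>)"

definition orthonormal_system :: "'a measure \<Rightarrow> 'j set \<Rightarrow> ('j \<Rightarrow> 'a \<Rightarrow> complex) \<Rightarrow> bool" where
  "orthonormal_system \<mu> J f \<longleftrightarrow>
     (\<forall>j\<in>J. f j \<in> L2 \<mu>) \<and>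
     (\<forall>i\<in>J. \<forall>j\<in>J. L2_inner \<mu> (f i) (f j) = (if i = j then 1 else 0))"

definition L2_sums :: "'a measure \<Rightarrow> (nat \<Rightarrow> 'a \<Rightarrow> complex) \<Rightarrow> ('a \<Rightarrow> complex) \<Rightarrow> bool" where
  "L2_sums \<mu> F u \<longleftrightarrow> (\<forall>k. F k \<in> L2 \<mu>) \<and> u \<in> L2 \<mu> \<and>
     (\<lambda>n. \<integral>x. (cmod (u x - (\<Sum>k<n. F k x)))\<^sup>2 \<partial>\<mu>) \<longlonglongrightarrow> 0"

definition L2_suminf :: "'a measure \<Rightarrow> (nat \<Rightarrow> 'a \<Rightarrow> complex) \<Rightarrow> 'a \<Rightarrow> complex" where
  "L2_suminf \<mu> F = (SOME u. L2_sums \<mu> F u)"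

definition fourier_coeff :: "'a measure \<Rightarrow> (nat \<Rightarrow> 'a \<Rightarrow> complex) \<Rightarrow> ('a \<Rightarrow> complex) \<Rightarrow> nat \<Rightarrow> complex" where
  "fourier_coeff \<mu> e f k = L2_inner \<mu> f (e k)"

definition orthonormal_basis :: "'a measure \<Rightarrow> (nat \<Rightarrow> 'a \<Rightarrow> complex) \<Rightarrow> bool" where
  "orthonormal_basis \<mu> e \<longleftrightarrow> orthonormal_system \<mu> UNIV e \<and>
     (\<forall>f\<in>L2 \<mu>. L2_sums \<mu> (\<lambda>k x. fourier_coeff \<mu> e f k * e k x) f)"

definition laplace_eigenbasis ::
  "('a, 'n::finite) chart set \<Rightarrow> (('a, 'n) chart \<Rightarrow> 'a \<Rightarrow> real^'n^'n) \<Rightarrow> 'a measure \<Rightarrow>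
   (nat \<Rightarrow> 'a \<Rightarrow> complex) \<Rightarrow> (nat \<Rightarrow> real) \<Rightarrow> bool" where
  "laplace_eigenbasis A g \<mu> e l \<longleftrightarrow>
     orthonormal_basis \<mu> e \<and>
     (\<forall>k. sqrt_laplace_eigenfunction A g (l k) (e k)) \<and>
     l 0 = 0 \<and> 0 < l 1 \<and> mono l"

(* exp (i t Delta^(a/2)) f, where l k is the k-th eigenvalue of the square root of Delta *)
definition propagator ::
  "'a measure \<Rightarrow> (nat \<Rightarrow> 'a \<Rightarrow> complex) \<Rightarrow> (nat \<Rightarrow> real) \<Rightarrow> real \<Rightarrow> real \<Rightarrow> ('a \<Rightarrow> complex) \<Rightarrow> 'a \<Rightarrow> complex" where
  "propagator \<mu> e l a t f =
     L2_suminf \<mu> (\<lambda>k x. exp (\<i> * of_real (t * l k powr a)) * fourier_coeff \<mu> e f k * e k x)"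


section \<open>Lebesgue norms\<close>

(* 1/r as a real number, with 1/\<infinity> = 0; only used for r > 0 *)
definition recip :: "ennreal \<Rightarrow> real" where
  "recip r = enn2real (inverse r)"

(* x^s for s > 0 *)
definition ennreal_rpow :: "ennreal \<Rightarrow> real \<Rightarrow> ennreal" where
  "ennreal_rpow x s = (if x = \<infinity> then \<infinity> else ennreal (enn2real x powr s))"

(* The (quasi-)norm of a nonnegative function h in L^r(\<mu>), 0 < r \<le> \<infinity>; the value \<infinity> is allowed. *)
definition Lnorm :: "'a measure \<Rightarrow> ennreal \<Rightarrow> ('a \<Rightarrow> ennreal) \<Rightarrow> ennreal" where
  "Lnorm \<mu> r h =
     (if r = \<infinity> then esssup \<mu> h
      else ennreal_rpow (\<integral>\<^sup>+x. ennreal_rpow (h x) (enn2real r) \<partial>\<mu>) (recip r))"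

definition mixed_norm ::
  "real set \<Rightarrow> 'a measure \<Rightarrow> ennreal \<Rightarrow> ennreal \<Rightarrow> (real \<Rightarrow> 'a \<Rightarrow> complex) \<Rightarrow> ennreal" where
  "mixed_norm I \<mu> a b F =
     Lnorm (restrict_space lborel I) a (\<lambda>t. Lnorm \<mu> b (\<lambda>x. ennreal (cmod (F t x))))"

definition lnorm :: "'j set \<Rightarrow> ennreal \<Rightarrow> ('j \<Rightarrow> complex) \<Rightarrow> ennreal" where
  "lnorm J b \<nu> = Lnorm (count_space J) b (\<lambda>j. ennreal (cmod (\<nu> j)))"


section \<open>The Strichartz estimate for orthonormal systems\<close>

(* The estimate at frequency N on the time interval I with constant C. An orthonormal system
   (f j) for j in J with Fourier support in {k. l k \<le> N} is automatically finite, since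
   l k tends to infinity. *)
definition orthonormal_strichartz ::
  "'a measure \<Rightarrow> (nat \<Rightarrow> 'a \<Rightarrow> complex) \<Rightarrow> (nat \<Rightarrow> real) \<Rightarrow> real \<Rightarrow> ennreal \<Rightarrow> ennreal \<Rightarrow> real \<Rightarrow> ennreal \<Rightarrow>
   real \<Rightarrow> real \<Rightarrow> real set \<Rightarrow> bool" where
  "orthonormal_strichartz \<mu> e l a p q \<sigma> \<beta> C N I \<longleftrightarrow>
     (\<forall>(J :: nat set) f \<nu>.
        orthonormal_system \<mu> J f \<longrightarrow>
        (\<forall>j\<in>J. {k. fourier_coeff \<mu> e (f j) k \<noteq> 0} \<subseteq> {k. l k \<le> N}) \<longrightarrow>
        lnorm J \<beta> \<nu> < \<infinity> \<longrightarrow>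
        mixed_norm I \<mu> (p / 2) (q / 2)
            (\<lambda>t x. \<Sum>\<^sub>\<infinity>j\<in>J. \<nu> j * of_real ((cmod (propagator \<mu> e l a t (f j) x))\<^sup>2))
          \<le> ennreal (C * measure lborel I powr (2 * recip p) * N powr \<sigma>) * lnorm J \<beta> \<nu>)"

end

(* Localise a bump of width 1/N at a point. Two integrations by parts in a chart show that most of
   its spectral mass lies below frequency N. Cut that part of the spectrum into O(N) bands on which
   lambda^alpha varies by O(1/|I|). The normalised projections of the bump onto the bands form an
   orthonormal system, and since phases within a band stay aligned on I (after focusing at some
   time of I), at every time of I the system has total mass bounded below on the support of the
   bump, a set of volume O(N^-d). Hoelder's inequality on that set gives the density an L^(q/2) norm
   of at least c N^(d - 2d/q), to be compared with the upper bound
   C N^(sigma + 1/beta). *)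
theory Submission
  imports Defs
begin

section \<open>Functions of class C1\<close>

text \<open>The number of bands is \<open>O(N)\<close> because the lengths of the intervals are
  matched to the frequency: for \<lambda> \<le> N the quantity \<lambda>^\<alpha> |I| is at most of
  order N^\<alpha> N^(1-\<alpha>) = N. With all weights equal to 1 this is the source of
  N^(1/\<beta>). The spectral tail is controlled by an exact identity. Eigenfunctions are smooth and
  the bump lives in one chart, so moving the Laplacian onto the bump multiplies its k-th Fourier
  coefficient by -\<lambda>_k^2. Bessel's inequality then bounds the mass above N by N^-4 times the
  squared norm of the Laplacian of the bump. At width K/N this is a multiple of K^-4 of the total
  mass, so a large K makes it at most a quarter. The delicate object is the propagator: at every
  time it is some chosen limit in L2. Its values at points, and its dependence on time, are
  therefore out of reach. All information comes from inner products with the bump, and the time norm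
  is bounded below by monotonicity alone. Since the lower bound holds at every time of I, the factor
  |I|^(2/p) appears on both sides and p drops out.\<close>

lemma partial_eqI:
  "(f has_derivative D) (at y) \<Longrightarrow> partial i f y = D (axis i 1)"
  unfolding partial_def using frechet_derivative_at by metis

lemma C1_onI:
  assumes "open S" "\<And>y. y \<in> S \<Longrightarrow> (f has_derivative D y) (at y)"
    "\<And>i. continuous_on S (\<lambda>y. D y (axis i 1))"
  shows "Ck_on (Suc 0) S f"
proof -
  have "continuous_on S (partial i f)" for i
    using assms(3)[of i] by (rule continuous_on_eq) (simp add: partial_eqI[OF assms(2)])
  then show ?thesis
    using assms(2) by (auto simp: differentiable_on_def differentiable_def
        intro: has_derivative_at_withinI)
qed

lemma C1_on_has_derivative:
  assumes "open S" "Ck_on (Suc 0) S f" "y \<in> S"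
  shows "(f has_derivative frechet_derivative f (at y)) (at y)"
  using assms by (simp add: differentiable_on_eq_differentiable_at frechet_derivative_works)

lemma C1_on_continuous_partial: "Ck_on (Suc 0) S f \<Longrightarrow> continuous_on S (partial i f)"
  by simp

lemma Ck_on_Suc_imp_continuous: "Ck_on (Suc k) S f \<Longrightarrow> continuous_on S f"
  by (simp add: differentiable_imp_continuous_on)

lemma C1_on_subset:
  assumes "Ck_on (Suc 0) S f" "T \<subseteq> S"
  shows "Ck_on (Suc 0) T f"
  using assms by (auto intro: differentiable_on_subset continuous_on_subset)

lemma C1_on_const: "Ck_on (Suc 0) S (\<lambda>y. c)"
proof -
  have "partial i (\<lambda>y. c) = (\<lambda>_. 0)" for i :: 'a
    by (rule ext, rule partial_eqI[of _ "\<lambda>_. 0", simplified]) (rule has_derivative_const)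
  then show ?thesis by simp
qed

lemma partial_scaleR:
  fixes f :: "real^'n::finite \<Rightarrow> real" and h :: "real^'n \<Rightarrow> 'b::real_normed_vector"
  assumes "f differentiable at y" "h differentiable at y"
  shows "partial i (\<lambda>z. f z *\<^sub>R h z) y = f y *\<^sub>R partial i h y + partial i f y *\<^sub>R h y"
proof -
  note d = assms[unfolded frechet_derivative_works]
  show ?thesis
    using partial_eqI[OF has_derivative_scaleR[OF d]] by (simp add: partial_def)
qed

lemma C1_on_cong:
  assumes "open S" "Ck_on (Suc 0) S f" "\<And>y. y \<in> S \<Longrightarrow> f y = h y"
  shows "Ck_on (Suc 0) S h"
proof (rule C1_onI[OF assms(1), where D = "\<lambda>y. frechet_derivative f (at y)"])
  fix y assume "y \<in> S"
  then show "(h has_derivative frechet_derivative f (at y)) (at y)"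
    using has_derivative_transform_within_open[OF C1_on_has_derivative[OF assms(1,2)] assms(1)] assms(3)
    by blast
qed (use assms(2) in \<open>simp add: partial_def[abs_def]\<close>)

text \<open>Functions that agree near \<open>y\<close> have the same derivatives at
  \<open>y\<close>, so the choice inside \<open>frechet_derivative\<close> selects the same map for
  both, even at points where no derivative exists.\<close>

lemma partial_cong:
  assumes "open S" "y \<in> S" "\<And>z. z \<in> S \<Longrightarrow> f z = h z"
  shows "partial i f y = partial i h y"
proof -
  have "(f has_derivative D) (at y) \<longleftrightarrow> (h has_derivative D) (at y)" for D
    using has_derivative_transform_within_open[OF _ assms(1,2)] assms(3) by metis
  then show ?thesis
    by (simp add: partial_def frechet_derivative_def)
qed

text \<open>Being C1 is local on open sets. This glues a function given on a chart domain to the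
  zero function outside a compact support.\<close>

lemma C1_on_Un:
  assumes "open S" "open T" "Ck_on (Suc 0) S f" "Ck_on (Suc 0) T f"
  shows "Ck_on (Suc 0) (S \<union> T) f"
  using assms
  by (auto simp: differentiable_on_eq_differentiable_at open_Un intro: continuous_on_open_Un)

lemma C1_on_scaleR:
  fixes f :: "real^'n::finite \<Rightarrow> real" and h :: "real^'n \<Rightarrow> 'b::real_normed_vector"
  assumes S: "open S" and f: "Ck_on (Suc 0) S f" and h: "Ck_on (Suc 0) S h"
  shows "Ck_on (Suc 0) S (\<lambda>y. f y *\<^sub>R h y)"
proof (rule C1_onI[OF S])
  fix y assume "y \<in> S"
  then show "((\<lambda>y. f y *\<^sub>R h y) has_derivative (\<lambda>v. f y *\<^sub>R frechet_derivative h (at y) v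
      + frechet_derivative f (at y) v *\<^sub>R h y)) (at y)"
    by (intro has_derivative_scaleR C1_on_has_derivative[OF S] f h)
next
  fix i
  show "continuous_on S (\<lambda>y. f y *\<^sub>R frechet_derivative h (at y) (axis i 1)
      + frechet_derivative f (at y) (axis i 1) *\<^sub>R h y)"
    using f h Ck_on_Suc_imp_continuous[OF f] Ck_on_Suc_imp_continuous[OF h]
    by (auto simp: partial_def[abs_def] intro!: continuous_intros)
qed

lemmas C1_on_mult = C1_on_scaleR[where 'b=real, simplified real_scaleR_def]

lemma C1_on_add:
  assumes S: "open S" and f: "Ck_on (Suc 0) S f" and h: "Ck_on (Suc 0) S h"
  shows "Ck_on (Suc 0) S (\<lambda>y. f y + h y)"
proof (rule C1_onI[OF S])
  fix y assume "y \<in> S"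
  then show "((\<lambda>y. f y + h y) has_derivative (\<lambda>v. frechet_derivative f (at y) v
      + frechet_derivative h (at y) v)) (at y)"
    by (intro has_derivative_add C1_on_has_derivative[OF S] f h)
next
  fix i
  show "continuous_on S (\<lambda>y. frechet_derivative f (at y) (axis i 1)
      + frechet_derivative h (at y) (axis i 1))"
    using f h by (auto simp: partial_def[abs_def] intro!: continuous_intros)
qed

lemma C1_on_sum:
  assumes "open S" "\<And>j. j \<in> J \<Longrightarrow> Ck_on (Suc 0) S (f j)"
  shows "Ck_on (Suc 0) S (\<lambda>y. \<Sum>j\<in>J. f j y)"
  using assms(2)
proof (induction J rule: infinite_finite_induct)
  case (insert x F)
  then show ?case
    by (simp del: Ck_on.simps add: C1_on_add[OF assms(1)])
qed (simp_all del: Ck_on.simps add: C1_on_const)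

lemma C1_on_prod:
  fixes f :: "'j \<Rightarrow> real^'n::finite \<Rightarrow> real"
  assumes "open S" "\<And>j. j \<in> J \<Longrightarrow> Ck_on (Suc 0) S (f j)"
  shows "Ck_on (Suc 0) S (\<lambda>y. \<Prod>j\<in>J. f j y)"
  using assms(2)
proof (induction J rule: infinite_finite_induct)
  case (insert x F)
  then show ?case
    by (simp del: Ck_on.simps add: C1_on_mult[OF assms(1)])
qed (simp_all del: Ck_on.simps add: C1_on_const)

lemma C1_on_bounded_linear:
  assumes L: "bounded_linear L" and S: "open S" and f: "Ck_on (Suc 0) S f"
  shows "Ck_on (Suc 0) S (\<lambda>y. L (f y))"
proof (rule C1_onI[OF S])
  fix y assume "y \<in> S"
  then show "((\<lambda>y. L (f y)) has_derivative (\<lambda>v. L (frechet_derivative f (at y) v))) (at y)"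
    by (intro bounded_linear.has_derivative[OF L] C1_on_has_derivative[OF S] f)
next
  fix i
  show "continuous_on S (\<lambda>y. L (frechet_derivative f (at y) (axis i 1)))"
    using f by (auto simp: partial_def[abs_def] intro!: bounded_linear.continuous_on[OF L])
qed

lemma C1_on_compose_real:
  fixes f :: "real^'n::finite \<Rightarrow> real"
  assumes S: "open S" and f: "Ck_on (Suc 0) S f"
    and h: "\<And>y. y \<in> S \<Longrightarrow> (h has_real_derivative h' (f y)) (at (f y))"
    and h': "continuous_on (f ` S) h'"
  shows "Ck_on (Suc 0) S (\<lambda>y. h (f y))"
proof (rule C1_onI[OF S])
  fix y assume y: "y \<in> S"
  show "((\<lambda>y. h (f y)) has_derivative (\<lambda>v. h' (f y) * frechet_derivative f (at y) v)) (at y)"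
    using has_derivative_compose[OF C1_on_has_derivative[OF S f y] h[OF y, unfolded has_field_derivative_def]] .
next
  fix i
  have "continuous_on S (\<lambda>y. h' (f y))"
    using continuous_on_compose[OF Ck_on_Suc_imp_continuous[OF f] h'] by (simp add: o_def)
  then show "continuous_on S (\<lambda>y. h' (f y) * frechet_derivative f (at y) (axis i 1))"
    using f by (auto simp: partial_def[abs_def] intro!: continuous_intros)
qed

lemma C1_on_inverse:
  fixes f :: "real^'n::finite \<Rightarrow> real"
  assumes S: "open S" and f: "Ck_on (Suc 0) S f" and nz: "\<And>y. y \<in> S \<Longrightarrow> f y \<noteq> 0"
  shows "Ck_on (Suc 0) S (\<lambda>y. inverse (f y))"
  by (rule C1_on_compose_real[OF S f, where h' = "\<lambda>x. - inverse (x^2)"])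
    (use nz in \<open>auto intro!: continuous_intros derivative_eq_intros simp: power2_eq_square\<close>)

lemma C1_on_sqrt:
  fixes f :: "real^'n::finite \<Rightarrow> real"
  assumes S: "open S" and f: "Ck_on (Suc 0) S f" and pos: "\<And>y. y \<in> S \<Longrightarrow> f y > 0"
  shows "Ck_on (Suc 0) S (\<lambda>y. sqrt (f y))"
  by (rule C1_on_compose_real[OF S f DERIV_real_sqrt])
    (use pos in \<open>force intro!: continuous_intros\<close>)+

section \<open>Determinants and inverses of matrix-valued functions\<close>

lemma C1_on_det:
  fixes G :: "real^'n::finite \<Rightarrow> real^'m^'m"
  assumes S: "open S" and G: "\<And>i j. Ck_on (Suc 0) S (\<lambda>y. G y $ i $ j)"
  shows "Ck_on (Suc 0) S (\<lambda>y. det (G y))"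
  unfolding det_def
  by (intro C1_on_sum C1_on_mult C1_on_prod C1_on_const S G)

text \<open>Cramer's rule makes each entry of the inverse a polynomial in the entries of
  \<open>A\<close> divided by the determinant, a form from which differentiability can be read
  off.\<close>

lemma matrix_inv_cramer:
  fixes A :: "real^'m^'m"
  assumes "det A \<noteq> 0"
  shows "matrix_inv A $ i $ j =
    det (\<chi> r s. if s = i then axis j 1 $ r else A $ r $ s) * inverse (det A)"
proof -
  have "A ** matrix_inv A = mat 1"
    using assms someI_ex[of "\<lambda>B. A ** B = mat 1 \<and> B ** A = mat 1"]
    by (auto simp: matrix_inv_def invertible_def simp flip: invertible_det_nz)
  then have "A *v (matrix_inv A *v axis j 1) = axis j 1"
    by (simp add: matrix_vector_mul_assoc)
  then have "matrix_inv A *v axis j 1 = (\<chi> k. det (\<chi> r s. if s = k then axis j 1 $ r else A $ r $ s) / det A)"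
    using cramer[OF assms] by blast
  then have "(matrix_inv A *v axis j 1) $ i = det (\<chi> r s. if s = i then axis j 1 $ r else A $ r $ s) / det A"
    by simp
  then show ?thesis
    by (simp add: matrix_vector_mul_component matrix_vector_mult_basis column_def divide_inverse)
qed

lemma C1_on_matrix_inv:
  fixes G :: "real^'n::finite \<Rightarrow> real^'m^'m"
  assumes S: "open S" and G: "\<And>i j. Ck_on (Suc 0) S (\<lambda>y. G y $ i $ j)"
    and nz: "\<And>y. y \<in> S \<Longrightarrow> det (G y) \<noteq> 0"
  shows "Ck_on (Suc 0) S (\<lambda>y. matrix_inv (G y) $ i $ j)"
proof -
  have "Ck_on (Suc 0) S (\<lambda>y. (\<chi> r s. if s = i then axis j 1 $ r else G y $ r $ s) $ r $ s)" for r s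
    by (cases "s = i") (simp_all del: Ck_on.simps add: C1_on_const G)
  then have "Ck_on (Suc 0) S (\<lambda>y. det (\<chi> r s. if s = i then axis j 1 $ r else G y $ r $ s) * inverse (det (G y)))"
    by (intro C1_on_mult C1_on_inverse C1_on_det S G nz)
  then show ?thesis
    by (rule C1_on_cong[OF S]) (simp add: matrix_inv_cramer nz)
qed

text \<open>The quadratic form stays positive along the segment \<open>H\<close> from the identity
  to \<open>A\<close>, so the determinant has no zero there; as it starts at 1, a nonpositive end
  value would contradict the intermediate value theorem.\<close>

lemma det_pos_of_pos_def:
  fixes A :: "real^'m^'m"
  assumes "\<And>v. v \<noteq> 0 \<Longrightarrow> v \<bullet> (A *v v) > 0"
  shows "det A > 0"
proof (rule ccontr)
  define H where "H t = (\<chi> i j. (1 - t) * mat 1 $ i $ j + t * A $ i $ j)" for t :: real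
  have Hv: "H t *v v = (1 - t) *\<^sub>R v + t *\<^sub>R (A *v v)" for t v
  proof -
    have "H t = (1 - t) *\<^sub>R mat 1 + t *\<^sub>R A"
      by (simp add: H_def vec_eq_iff)
    then show ?thesis
      by (simp add: matrix_vector_mult_add_rdistrib flip: scaleR_matrix_vector_assoc)
  qed
  have nz: "det (H t) \<noteq> 0" if "0 \<le> t" "t \<le> 1" for t
  proof
    assume "det (H t) = 0"
    then obtain v where v: "v \<noteq> 0" "H t *v v = 0"
      by (metis invertible_det_nz invertible_left_inverse matrix_left_invertible_ker)
    have "0 = v \<bullet> (H t *v v)" using v by simp
    also have "\<dots> = (1 - t) * (v \<bullet> v) + t * (v \<bullet> (A *v v))"
      by (simp add: Hv inner_add_right)
    also have "\<dots> > 0"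
      using assms[OF v(1)] that v(1)
      by (cases "t = 1") (auto intro!: add_pos_nonneg)
    finally show False by simp
  qed
  assume "\<not> det A > 0"
  moreover have "H 1 = A" "H 0 = mat 1" by (simp_all add: H_def vec_eq_iff)
  moreover have "continuous_on {0..1} (\<lambda>t. det (H t))"
    unfolding det_def H_def by (auto intro!: continuous_intros)
  ultimately have "\<exists>t\<ge>0. t \<le> 1 \<and> det (H t) = 0"
    by (intro IVT2') auto
  then show False using nz by blast
qed


section \<open>Integration by parts\<close>

lemma partial_eq_0:
  assumes "open S" "y \<in> S" "\<And>z. z \<in> S \<Longrightarrow> f z = 0"
  shows "partial i f y = 0"
  using partial_cong[OF assms(1,2), where h = "\<lambda>_. 0"] assms(3)
    partial_eqI[OF has_derivative_const] by metis

lemma compact_support_bounded_partial: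
  assumes C1: "Ck_on (Suc 0) UNIV F" and supp: "\<And>y. y \<notin> cball a r \<Longrightarrow> F y = 0"
  obtains B where "0 \<le> B" "\<And>y. norm (partial i F y) \<le> B"
proof -
  have z: "partial i F y = 0" if "y \<notin> cball a r" for y
    by (rule partial_eq_0[of "- cball a r"]) (use that supp in \<open>auto simp: open_Compl\<close>)
  have "compact (partial i F ` cball a r)"
    using C1 by (intro compact_continuous_image continuous_on_subset[OF C1_on_continuous_partial[OF C1]]) auto
  then obtain B where "0 \<le> B" "\<And>y. y \<in> cball a r \<Longrightarrow> norm (partial i F y) \<le> B"
    using compact_imp_bounded bounded_pos by (metis image_eqI less_imp_le)
  then show ?thesis
    using z by (intro that[of B]) (metis norm_zero)+
qed

lemma integrable_compact_support:
  fixes F :: "'c::euclidean_space \<Rightarrow> 'b::euclidean_space"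
  assumes "continuous_on UNIV F" "\<And>y. y \<notin> cball a r \<Longrightarrow> F y = 0"
  shows "integrable lborel F"
proof -
  have "integrable lborel (\<lambda>y. indicator (cball a r) y *\<^sub>R F y)"
    by (intro borel_integrable_compact) (auto intro: continuous_on_subset[OF assms(1)])
  moreover have "indicator (cball a r) y *\<^sub>R F y = F y" for y
    using assms(2) by (auto simp: indicator_def)
  ultimately show ?thesis by simp
qed

lemma lborel_integral_translation:
  fixes F :: "'c::euclidean_space \<Rightarrow> 'b::euclidean_space"
  assumes "F \<in> borel_measurable borel"
  shows "integral\<^sup>L lborel (\<lambda>y. F (v + y)) = integral\<^sup>L lborel F"
proof -
  have "integral\<^sup>L lborel F = integral\<^sup>L (distr lborel borel ((+) v)) F"
    by (simp add: lborel_distr_plus)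
  also have "\<dots> = integral\<^sup>L lborel (\<lambda>y. F (v + y))"
    by (rule integral_distr) (use assms in auto)
  finally show ?thesis by simp
qed

text \<open>Translation invariance makes every difference quotient integrate to zero, and the quotients
  are uniformly bounded with support in a fixed ball, so one may pass to the limit.\<close>
lemma integral_partial_eq_0:
  fixes F :: "real^'n::finite \<Rightarrow> 'b::euclidean_space"
  assumes C1: "Ck_on (Suc 0) UNIV F" and supp: "\<And>y. y \<notin> cball a r \<Longrightarrow> F y = 0"
  shows "integral\<^sup>L lborel (partial i F) = 0"
proof -
  obtain B where B: "0 \<le> B" "\<And>y. norm (partial i F y) \<le> B"
    using compact_support_bounded_partial[OF assms] by metis
  define v where "v = (axis i 1 :: real^'n)"
  have nv: "norm v = 1" by (simp add: v_def)
  have d: "(F has_derivative frechet_derivative F (at y)) (at y)" for y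
    using C1_on_has_derivative[OF open_UNIV C1] by simp
  have dl: "((\<lambda>s. F (y + s *\<^sub>R v)) has_vector_derivative partial i F (y + t *\<^sub>R v)) (at t within T)" for y t T
  proof -
    have "((\<lambda>s. y + s *\<^sub>R v) has_derivative (\<lambda>s. s *\<^sub>R v)) (at t within T)"
      by (auto intro!: derivative_eq_intros)
    from has_derivative_compose[OF this d]
    show ?thesis
      by (simp add: has_vector_derivative_def partial_def v_def
          linear_scale[OF has_derivative_linear[OF d]])
  qed
  have Lip: "norm (F (y + t *\<^sub>R v) - F y) \<le> B * \<bar>t\<bar>" for y t
  proof -
    have "norm (F (y + t *\<^sub>R v) - F (y + 0 *\<^sub>R v)) \<le> B * norm (t - 0)"
      by (rule differentiable_bound[where S = UNIV and f' = "\<lambda>t h. h *\<^sub>R partial i F (y + t *\<^sub>R v)"])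
        (use dl in \<open>auto simp: has_vector_derivative_def mult.commute[of B] intro!: onorm_le mult_left_mono B\<close>)
    then show ?thesis by simp
  qed
  define s where "s n y = real (Suc n) *\<^sub>R (F (inverse (real (Suc n)) *\<^sub>R v + y) - F y)" for n y
  have contF: "continuous_on UNIV F" by (rule Ck_on_Suc_imp_continuous[OF C1])
  have meas: "F \<in> borel_measurable borel" by (rule borel_measurable_continuous_onI[OF contF])
  have intF: "integrable lborel F" by (rule integrable_compact_support[OF contF supp])
  have conts: "continuous_on UNIV (s n)" for n
    unfolding s_def by (intro continuous_intros continuous_on_compose2[OF contF]) auto
  have lim: "(\<lambda>n. s n y) \<longlonglongrightarrow> partial i F y" for y
  proof -
    \<comment> \<open>\<open>R\<close> is the quotient from the definition of the derivative along
      the axis. At the positive times 1/(n+1) it is exactly the error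
      \<open>s n y - partial i F y\<close>.\<close>
    define R where "R t = (1 / norm (t - 0)) *\<^sub>R
      (F (y + t *\<^sub>R v) - (F (y + 0 *\<^sub>R v) + (t - 0) *\<^sub>R partial i F (y + 0 *\<^sub>R v)))" for t
    have "(R \<longlongrightarrow> 0) (at 0)"
      using dl[of y 0 UNIV] unfolding has_vector_derivative_def has_derivative_within R_def[abs_def] by blast
    moreover have "filterlim (\<lambda>n. inverse (real (Suc n))) (at 0) sequentially"
      unfolding filterlim_at using LIMSEQ_inverse_real_of_nat by (auto simp del: of_nat_Suc)
    ultimately have "(\<lambda>n. R (inverse (real (Suc n)))) \<longlonglongrightarrow> 0"
      by (rule filterlim_compose)
    moreover have "R (inverse (real (Suc n))) = s n y - partial i F y" for n
      by (simp add: R_def s_def algebra_simps inverse_eq_divide del: of_nat_Suc)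
    ultimately show ?thesis
      by (simp add: LIM_zero_iff)
  qed
  have zero: "integral\<^sup>L lborel (s n) = 0" for n
  proof -
    have int2: "integrable lborel (\<lambda>y. F (inverse (real (Suc n)) *\<^sub>R v + y))"
      by (rule integrable_compact_support[where a = "a - inverse (real (Suc n)) *\<^sub>R v" and r = r])
        (use supp in \<open>auto simp: dist_norm algebra_simps intro!: continuous_intros continuous_on_compose2[OF contF]\<close>)
    show ?thesis
      unfolding s_def
      by (simp add: Bochner_Integration.integral_diff[OF int2 intF] lborel_integral_translation[OF meas] del: of_nat_Suc)
  qed
  have "(\<lambda>n. integral\<^sup>L lborel (s n)) \<longlonglongrightarrow> integral\<^sup>L lborel (partial i F)"
  \<comment> \<open>The shifts have length at most 1, so every quotient vanishes outside the ball of
    radius \<open>r + 1\<close>; inside it \<open>Lip\<close> bounds the quotient by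
    \<open>B\<close>.\<close>
  proof (rule integral_dominated_convergence[where w = "\<lambda>y. B * indicator (cball a (r + 1)) y"])
    show "partial i F \<in> borel_measurable lborel"
      using C1_on_continuous_partial[OF C1] by (simp add: borel_measurable_continuous_onI)
    show "s n \<in> borel_measurable lborel" for n
      using conts by (simp add: borel_measurable_continuous_onI)
    show "integrable lborel (\<lambda>y. B * indicator (cball a (r + 1)) y)"
      by (intro integrable_mult_right integrable_real_indicator) (use emeasure_lborel_cball_finite[of a "r + 1"] in \<open>auto simp: top_unique less_top\<close>)
    show "AE y in lborel. (\<lambda>n. s n y) \<longlonglongrightarrow> partial i F y" using lim by simp
    have "norm (s n y) \<le> B * indicator (cball a (r + 1)) y" for n y
    proof (cases "y \<in> cball a (r + 1)")
      case True
      have "norm (s n y) = real (Suc n) * norm (F (y + inverse (real (Suc n)) *\<^sub>R v) - F y)"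
        by (simp add: s_def add.commute del: of_nat_Suc)
      also have "\<dots> \<le> real (Suc n) * (B * \<bar>inverse (real (Suc n))\<bar>)"
        by (intro mult_left_mono Lip) auto
      also have "\<dots> = B" by (simp add: field_simps del: of_nat_Suc)
      finally show ?thesis using True by simp
    next
      case False
      have le1: "inverse (real (Suc n)) \<le> 1" by (simp add: field_simps)
      have "dist a y \<le> dist a (inverse (real (Suc n)) *\<^sub>R v + y) + dist (inverse (real (Suc n)) *\<^sub>R v + y) y"
        by (rule dist_triangle)
      also have "dist (inverse (real (Suc n)) *\<^sub>R v + y) y \<le> 1"
        using le1 by (simp add: dist_norm nv del: of_nat_Suc)
      finally have "inverse (real (Suc n)) *\<^sub>R v + y \<notin> cball a r" "y \<notin> cball a r"
        using False by auto
      then show ?thesis using supp B(1) by (simp add: s_def)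
    qed
    then show "AE y in lborel. norm (s n y) \<le> B * indicator (cball a (r + 1)) y" for n by simp
  qed
  then show ?thesis by (simp add: zero LIMSEQ_const_iff)
qed


lemma integral_by_parts:
  fixes f :: "real^'n::finite \<Rightarrow> real" and X :: "real^'n \<Rightarrow> 'b::euclidean_space"
  assumes S: "open S" and K: "cball a r \<subseteq> S"
    and f: "Ck_on (Suc 0) UNIV f" and supp: "\<And>y. y \<notin> cball a r \<Longrightarrow> f y = 0"
    and X: "Ck_on (Suc 0) S X"
  shows "integrable lborel (\<lambda>y. f y *\<^sub>R partial i X y)"
    and "integrable lborel (\<lambda>y. partial i f y *\<^sub>R X y)"
    and "(\<integral>y. f y *\<^sub>R partial i X y \<partial>lborel) = - (\<integral>y. partial i f y *\<^sub>R X y \<partial>lborel)"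
proof -
  let ?F = "\<lambda>y. f y *\<^sub>R X y"
  note op = S open_Compl[OF closed_cball, of a r]
  have cover: "S \<union> - cball a r = UNIV" using K by auto
  have pf0: "partial i f y = 0" if "y \<notin> cball a r" for y
    by (rule partial_eq_0[OF op(2)]) (use that supp in auto)
  have pF0: "partial i ?F y = 0" if "y \<notin> cball a r" for y
    by (rule partial_eq_0[OF op(2)]) (use that supp in auto)
  \<comment> \<open>\<open>X\<close> is controlled only on \<open>S\<close>. The product is C1 on
    \<open>S\<close> and zero off the closed ball, and these two open sets cover the space, so it is
    C1 everywhere.\<close>
  have F: "Ck_on (Suc 0) UNIV ?F"
  proof -
    have "Ck_on (Suc 0) S ?F"
      by (rule C1_on_scaleR[OF S C1_on_subset[OF f] X]) simp
    moreover have "Ck_on (Suc 0) (- cball a r) ?F"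
      by (rule C1_on_cong[OF op(2) C1_on_const[where c = 0]]) (use supp in auto)
    ultimately show ?thesis using C1_on_Un[OF op] cover by metis
  qed
  have cont: "continuous_on UNIV (\<lambda>y. h y *\<^sub>R Z y)"
    if "continuous_on UNIV h" "continuous_on S Z" "\<And>y. y \<notin> cball a r \<Longrightarrow> h y = 0"
    for h :: "real^'n \<Rightarrow> real" and Z :: "real^'n \<Rightarrow> 'b"
  proof -
    have "continuous_on S (\<lambda>y. h y *\<^sub>R Z y)"
      by (intro continuous_on_scaleR continuous_on_subset[OF that(1)] that(2)) simp
    moreover have "continuous_on (- cball a r) (\<lambda>y. h y *\<^sub>R Z y)"
      by (rule continuous_on_eq[OF continuous_on_const[where c = 0]]) (use that(3) in auto)
    ultimately show ?thesis using continuous_on_open_Un[OF op] cover by metis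
  qed
  show i1: "integrable lborel (\<lambda>y. f y *\<^sub>R partial i X y)"
    by (rule integrable_compact_support[OF cont[OF Ck_on_Suc_imp_continuous[OF f] C1_on_continuous_partial[OF X]]])
      (use supp in auto)
  show i2: "integrable lborel (\<lambda>y. partial i f y *\<^sub>R X y)"
    by (rule integrable_compact_support[OF cont[OF C1_on_continuous_partial[OF f] Ck_on_Suc_imp_continuous[OF X]]])
      (use pf0 in auto)
  have "partial i ?F y = f y *\<^sub>R partial i X y + partial i f y *\<^sub>R X y" for y
  proof (cases "y \<in> cball a r")
    case True
    then have "y \<in> S" using K by auto
    then show ?thesis
      using f X by (intro partial_scaleR) (auto simp: differentiable_on_eq_differentiable_at S)
  qed (simp add: pF0 pf0 supp)
  then have "partial i ?F = (\<lambda>y. f y *\<^sub>R partial i X y + partial i f y *\<^sub>R X y)" ..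
  then have "0 = integral\<^sup>L lborel (\<lambda>y. f y *\<^sub>R partial i X y + partial i f y *\<^sub>R X y)"
    using integral_partial_eq_0[OF F, of a r i] supp by simp
  also have "\<dots> = (\<integral>y. f y *\<^sub>R partial i X y \<partial>lborel) + (\<integral>y. partial i f y *\<^sub>R X y \<partial>lborel)"
    by (rule Bochner_Integration.integral_add[OF i1 i2])
  finally show "(\<integral>y. f y *\<^sub>R partial i X y \<partial>lborel) = - (\<integral>y. partial i f y *\<^sub>R X y \<partial>lborel)"
    by (simp add: eq_neg_iff_add_eq_0)
qed

text \<open>The formal transpose of the operator sum_i d_i (sum_j A_ij d_j): the outer derivative
  carries the second index of the coefficients.\<close>

definition div_op :: "('n::finite \<Rightarrow> 'n \<Rightarrow> real^'n \<Rightarrow> real) \<Rightarrow> (real^'n \<Rightarrow> real) \<Rightarrow> real^'n \<Rightarrow> real" where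
  "div_op A f y = (\<Sum>i\<in>UNIV. \<Sum>j\<in>UNIV. partial j (\<lambda>z. A i j z * partial i f z) y)"

lemma div_op_eq_0:
  assumes "\<And>z. z \<notin> cball a r \<Longrightarrow> f z = 0" "y \<notin> cball a r"
  shows "div_op A f y = 0"
proof -
  have "partial i f z = 0" if "z \<notin> cball a r" for i z
    by (rule partial_eq_0[of "- cball a r"]) (use that assms in \<open>auto simp: open_Compl\<close>)
  then have "partial j (\<lambda>z. A i j z * partial i f z) y = 0" for i j
    by (intro partial_eq_0[of "- cball a r"]) (use assms in \<open>auto simp: open_Compl\<close>)
  then show ?thesis by (simp add: div_op_def)
qed

lemma continuous_on_div_op:
  assumes S: "open S" and A: "\<And>i j. Ck_on (Suc 0) S (A i j)" and f: "Ck_on (Suc (Suc 0)) UNIV f"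
  shows "continuous_on S (div_op A f)"
proof -
  have "Ck_on (Suc 0) UNIV (partial i f)" for i
    using f by simp
  then have "Ck_on (Suc 0) S (\<lambda>z. A i j z * partial i f z)" for i j
    by (rule C1_on_mult[OF S A C1_on_subset]) simp
  then show ?thesis unfolding div_op_def[abs_def]
    by (intro continuous_on_sum C1_on_continuous_partial)
qed

text \<open>Moving both derivatives onto the test function transposes the coefficient matrix.\<close>
lemma integral_by_parts_twice:
  fixes f :: "real^'n::finite \<Rightarrow> real" and u :: "real^'n \<Rightarrow> 'b::euclidean_space"
  assumes S: "open S" and K: "cball a r \<subseteq> S"
    and f: "Ck_on (Suc (Suc 0)) UNIV f" and supp: "\<And>y. y \<notin> cball a r \<Longrightarrow> f y = 0"
    and A: "\<And>i j. Ck_on (Suc 0) S (A i j)"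
    and u: "Ck_on (Suc (Suc 0)) S u"
  shows "(\<integral>y. f y *\<^sub>R (\<Sum>i\<in>UNIV. partial i (\<lambda>z. \<Sum>j\<in>UNIV. A i j z *\<^sub>R partial j u z) y) \<partial>lborel)
    = (\<integral>y. div_op A f y *\<^sub>R u y \<partial>lborel)"
proof -
  have f1: "Ck_on (Suc 0) UNIV f" and f2: "\<And>i. Ck_on (Suc 0) UNIV (partial i f)"
    using f by (auto intro: differentiable_imp_continuous_on)
  have u1: "Ck_on (Suc 0) S u" and u2: "\<And>i. Ck_on (Suc 0) S (partial i u)"
    using u by (auto intro: differentiable_imp_continuous_on)
  note op = S open_Compl[OF closed_cball, of a r]
  have cover: "S \<union> - cball a r = UNIV" using K by auto
  have pf0: "partial i f y = 0" if "y \<notin> cball a r" for i y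
    by (rule partial_eq_0[OF op(2)]) (use that supp in auto)
  define X where "X i z = (\<Sum>j\<in>UNIV. A i j z *\<^sub>R partial j u z)" for i z
  have X: "Ck_on (Suc 0) S (X i)" for i
    unfolding X_def[abs_def] by (intro C1_on_sum C1_on_scaleR S A u2)
  \<comment> \<open>Extension by zero again: for the second integration by parts the compactly
    supported factor is the flux component \<open>A i j z * partial i f z\<close>.\<close>
  have Af: "Ck_on (Suc 0) UNIV (\<lambda>z. A i j z * partial i f z)" for i j
  proof -
    have "Ck_on (Suc 0) S (\<lambda>z. A i j z * partial i f z)"
      by (rule C1_on_mult[OF S A C1_on_subset[OF f2]]) simp
    moreover have "Ck_on (Suc 0) (- cball a r) (\<lambda>z. A i j z * partial i f z)"
      by (rule C1_on_cong[OF op(2) C1_on_const[where c = 0]]) (use pf0 in auto)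
    ultimately show ?thesis using C1_on_Un[OF op] cover by metis
  qed
  have z: "A i j y * partial i f y = 0" if "y \<notin> cball a r" for i j y
    using pf0[OF that] by simp
  have parts1: "integrable lborel (\<lambda>y. f y *\<^sub>R partial i (X i) y)"
    "(\<integral>y. f y *\<^sub>R partial i (X i) y \<partial>lborel) = - (\<integral>y. partial i f y *\<^sub>R X i y \<partial>lborel)" for i
    by (rule integral_by_parts[OF S K f1 _ X]; use supp in blast)+
  have parts2: "integrable lborel (\<lambda>y. (A i j y * partial i f y) *\<^sub>R partial j u y)"
    "integrable lborel (\<lambda>y. partial j (\<lambda>z. A i j z * partial i f z) y *\<^sub>R u y)"
    "(\<integral>y. (A i j y * partial i f y) *\<^sub>R partial j u y \<partial>lborel)
       = - (\<integral>y. partial j (\<lambda>z. A i j z * partial i f z) y *\<^sub>R u y \<partial>lborel)" for i j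
    by (rule integral_by_parts[OF S K Af _ u1]; use z in blast)+
  have eq: "partial i f y *\<^sub>R X i y = (\<Sum>j\<in>UNIV. (A i j y * partial i f y) *\<^sub>R partial j u y)" for i y
    by (simp add: X_def scaleR_right.sum mult.commute)
  have "(\<integral>y. f y *\<^sub>R (\<Sum>i\<in>UNIV. partial i (X i) y) \<partial>lborel)
      = (\<Sum>i\<in>UNIV. \<integral>y. f y *\<^sub>R partial i (X i) y \<partial>lborel)"
    by (simp add: scaleR_right.sum Bochner_Integration.integral_sum parts1(1))
  also have "\<dots> = (\<Sum>i\<in>UNIV. - (\<Sum>j\<in>UNIV. \<integral>y. (A i j y * partial i f y) *\<^sub>R partial j u y \<partial>lborel))"
    by (simp add: parts1(2) eq Bochner_Integration.integral_sum parts2(1))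
  also have "\<dots> = (\<Sum>i\<in>UNIV. \<Sum>j\<in>UNIV. \<integral>y. partial j (\<lambda>z. A i j z * partial i f z) y *\<^sub>R u y \<partial>lborel)"
    by (simp add: parts2(3) sum_negf)
  also have "\<dots> = (\<integral>y. div_op A f y *\<^sub>R u y \<partial>lborel)"
    by (simp add: div_op_def scaleR_left.sum Bochner_Integration.integral_sum parts2(2)
        Bochner_Integration.integrable_sum)
  finally show ?thesis by (simp add: X_def[abs_def])
qed


section \<open>Bump functions\<close>

text \<open>A truncated power of a quadratic polynomial, with k - 1 continuous derivatives across
  the sphere of radius \<open>r\<close>. The exponent 3 gives exactly the two derivatives that get
  moved onto it, and closed formulas for them show how they scale with \<open>r\<close>.\<close>

definition bump :: "nat \<Rightarrow> real^'n::finite \<Rightarrow> real \<Rightarrow> real^'n \<Rightarrow> real" where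
  "bump k a r y = (max 0 (1 - (norm (y - a))\<^sup>2 / r\<^sup>2)) ^ k"

lemma bump_nonneg: "0 \<le> bump k a r y"
  by (simp add: bump_def)

lemma bump_le_1: "bump k a r y \<le> 1"
  unfolding bump_def by (rule power_le_one) auto

lemma continuous_on_bump: "continuous_on UNIV (bump k a r)"
  unfolding bump_def[abs_def] divide_inverse by (intro continuous_intros)

lemma bump_eq_0: "0 < k \<Longrightarrow> 0 < r \<Longrightarrow> y \<notin> cball a r \<Longrightarrow> bump k a r y = 0"
  by (simp add: bump_def dist_norm norm_minus_commute max_def field_simps power_mono)

lemma bump_ge: "0 < r \<Longrightarrow> y \<in> cball a (r / 2) \<Longrightarrow> (3/4) ^ k \<le> bump k a r y"
proof -
  assume r: "0 < r" and y: "y \<in> cball a (r / 2)"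
  then have "(norm (y - a))\<^sup>2 \<le> (r / 2)\<^sup>2"
    by (intro power_mono) (auto simp: dist_norm norm_minus_commute)
  then have "(norm (y - a))\<^sup>2 / r\<^sup>2 \<le> 1 / 4"
      using r by (simp add: field_simps power2_eq_square)
  then have "3/4 \<le> max 0 (1 - (norm (y - a))\<^sup>2 / r\<^sup>2)" by linarith
  then show ?thesis unfolding bump_def by (rule power_mono) simp
qed

text \<open>Differentiation lowers the exponent by one and stays in the same family, so higher
  derivatives come from iterating this formula.\<close>

lemma has_derivative_bump:
  assumes "0 < k"
  shows "(bump (Suc k) a r has_derivative
     (\<lambda>v. - (2 * real (Suc k) / r\<^sup>2) * bump k a r y * ((y - a) \<bullet> v))) (at y)"
proof -
  let ?h = "\<lambda>s::real. (max 0 (1 - s)) ^ Suc k"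
  have "((\<lambda>s. (max 0 (1 - s)) ^ Suc k) has_real_derivative - (real (Suc k) * (max 0 (1 - s)) ^ k)) (at s)" for s
  proof -
    consider "s < 1" | "s > 1" | "s = 1" by linarith
    then show ?thesis
    proof cases
      case 1
      have "((\<lambda>s. (1 - s) ^ Suc k) has_real_derivative - (real (Suc k) * (1 - s) ^ k)) (at s)"
        by (auto intro!: derivative_eq_intros simp del: power_Suc)
      then have "((\<lambda>s. (1 - s) ^ Suc k) has_real_derivative - (real (Suc k) * (max 0 (1 - s)) ^ k)) (at s)"
        using 1 by (simp add: max_def)
      then show ?thesis
        by (rule has_field_derivative_transform_within_open[where S = "{..<1}"])
          (use 1 in \<open>auto simp: max_def\<close>)
    next
      case 2
      have "((\<lambda>s. 0) has_real_derivative 0) (at s)" by simp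
      then have "(?h has_real_derivative 0) (at s)"
        by (rule has_field_derivative_transform_within_open[where S = "{1<..}"]) (use 2 in auto)
      moreover have "- (real (Suc k) * (max 0 (1 - s)) ^ k) = 0"
        using 2 assms by (simp add: max_def)
      ultimately show ?thesis by metis
    next
      case 3
      \<comment> \<open>At the kink the difference quotient is dominated by the \<open>k\<close>-th
        power of the truncation, which tends to 0 because \<open>k\<close> is positive.\<close>
      have "((\<lambda>t. ?h t / (t - 1)) \<longlongrightarrow> 0) (at 1)"
      proof (rule Lim_null_comparison)
        have "norm (?h t / (t - 1)) \<le> (max 0 (1 - t)) ^ k" for t
          by (cases "t < 1") (auto simp: max_def abs_mult field_simps)
        then show "eventually (\<lambda>t. norm (?h t / (t - 1)) \<le> (max 0 (1 - t)) ^ k) (at 1)" by simp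
        have "((\<lambda>t::real. (max 0 (1 - t)) ^ k) \<longlongrightarrow> (max 0 (1 - 1)) ^ k) (at 1)"
          by (intro tendsto_intros)
        moreover have "(max 0 (1 - 1)) ^ k = (0::real)" using assms by simp
        ultimately show "((\<lambda>t::real. (max 0 (1 - t)) ^ k) \<longlongrightarrow> 0) (at 1)" by metis
      qed
      moreover have "- (real (Suc k) * (max 0 (1 - s)) ^ k) = 0" "?h s = 0"
        using 3 assms by (simp_all add: max_def zero_power)
      ultimately show ?thesis
        unfolding has_field_derivative_iff 3 by (simp del: power_Suc add: assms zero_power)
    qed
  qed
  note h = this[unfolded has_field_derivative_def]
  have "((\<lambda>y. (y - a) \<bullet> (y - a) * inverse (r\<^sup>2)) has_derivative (\<lambda>v. 2 * ((y - a) \<bullet> v) * inverse (r\<^sup>2))) (at y)"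
    by (auto intro!: derivative_eq_intros simp: inner_commute)
  note comp = has_derivative_compose[OF this h]
  have "bump (Suc k) a r = (\<lambda>y. ?h ((y - a) \<bullet> (y - a) * inverse (r\<^sup>2)))"
    by (simp add: bump_def fun_eq_iff dot_square_norm divide_inverse del: power_Suc)
  moreover have "- (real (Suc k) * (max 0 (1 - (y - a) \<bullet> (y - a) * inverse (r\<^sup>2))) ^ k)
      * (2 * ((y - a) \<bullet> v) * inverse (r\<^sup>2)) = - (2 * real (Suc k) / r\<^sup>2) * bump k a r y * ((y - a) \<bullet> v)" for v
    by (simp only: bump_def dot_square_norm divide_inverse minus_mult_left[symmetric] minus_mult_right[symmetric] mult_ac)
  ultimately show ?thesis using comp by (simp only:)
qed

lemma partial_bump:
  "0 < k \<Longrightarrow> partial i (bump (Suc k) a r) = (\<lambda>y. - (2 * real (Suc k) / r\<^sup>2) * (bump k a r y * (y - a) $ i))"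
  using partial_eqI[OF has_derivative_bump]
  by (auto simp: inner_axis mult.assoc fun_eq_iff simp del: of_nat_Suc)

lemma C1_bump: "0 < k \<Longrightarrow> Ck_on (Suc 0) UNIV (bump (Suc k) a r)"
  by (rule C1_onI[OF open_UNIV has_derivative_bump])
    (assumption | intro continuous_intros continuous_on_bump)+

lemma C1_component: "Ck_on (Suc 0) UNIV (\<lambda>y. (y - a) $ i)"
  by (rule C1_onI[where D = "\<lambda>_ v. v $ i"])
    (auto intro!: continuous_intros derivative_eq_intros bounded_linear.has_derivative[OF bounded_linear_vec_nth])

lemma partial_component: "partial j (\<lambda>y. (y - a) $ i) y = (if i = j then 1 else 0)"
proof -
  have "((\<lambda>y. (y - a) $ i) has_derivative (\<lambda>v. v $ i)) (at y)"
    by (auto intro!: derivative_eq_intros bounded_linear.has_derivative[OF bounded_linear_vec_nth])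
  from partial_eqI[OF this] show ?thesis by (simp add: axis_def)
qed

lemma C2_bump: "Ck_on (Suc (Suc 0)) UNIV (bump 3 a r)"
proof -
  have "Ck_on (Suc 0) UNIV (partial i (bump (Suc 2) a r))" for i
    unfolding partial_bump[OF zero_less_numeral]
    by (intro C1_on_mult C1_on_const C1_component open_UNIV)
      (use C1_bump[of 1 a r] in \<open>simp add: eval_nat_numeral\<close>)
  moreover have "bump (Suc 2) a r differentiable_on UNIV" using C1_bump[of 2 a r] by simp
  ultimately show ?thesis by (simp add: eval_nat_numeral)
qed

text \<open>The two differentiations produce the factors 2 * 3 / r^2 and 2 * 2 / r^2, and each
  coordinate of \<open>y - a\<close> is at most \<open>r\<close>. Hence 6 / r for the first order,
  and 6 * (1 + 4) / r^2 for the second.\<close>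

lemma bump_partial_bounds:
  assumes r: "0 < r" and y: "y \<in> cball a r"
  shows "\<bar>partial i (bump 3 a r) y\<bar> \<le> 6 / r"
    and "\<bar>partial j (partial i (bump 3 a r)) y\<bar> \<le> 30 / r\<^sup>2"
proof -
  have c: "\<bar>(y - a) $ i\<bar> \<le> r" for i
    using component_le_norm_cart[of "y - a" i] y by (simp add: dist_norm norm_minus_commute)
  have b: "\<bar>bump k a r y\<bar> \<le> 1" for k using bump_nonneg bump_le_1 abs_of_nonneg by metis
  have p1: "partial i (bump 3 a r) = (\<lambda>y. - (6 / r\<^sup>2) * (bump 2 a r y * (y - a) $ i))" for i
    using partial_bump[of 2 i a r] by (simp add: eval_nat_numeral)
  have p2: "partial j (bump 2 a r) = (\<lambda>y. - (4 / r\<^sup>2) * (bump 1 a r y * (y - a) $ j))" for j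
    using partial_bump[of 1 j a r] by (simp add: eval_nat_numeral)
  have "\<bar>bump 2 a r y * (y - a) $ i\<bar> \<le> 1 * r" unfolding abs_mult by (intro mult_mono b c) auto
  then have "(6 / r\<^sup>2) * \<bar>bump 2 a r y * (y - a) $ i\<bar> \<le> (6 / r\<^sup>2) * r"
    by (intro mult_left_mono) auto
  then show "\<bar>partial i (bump 3 a r) y\<bar> \<le> 6 / r"
    using r by (simp add: p1 abs_mult power2_eq_square)
  have d1: "bump 2 a r differentiable at y" "(\<lambda>y. (y - a) $ i) differentiable at y"
    using C1_bump[of 1 a r] C1_component[of a i]
    by (simp_all add: differentiable_on_eq_differentiable_at eval_nat_numeral)
  have d2: "(\<lambda>y. bump 2 a r y * (y - a) $ i) differentiable at y"
    using d1 by (rule differentiable_mult)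
  have "partial j (partial i (bump 3 a r)) y
     = - (6 / r\<^sup>2) * partial j (\<lambda>y. bump 2 a r y * (y - a) $ i) y"
    using partial_scaleR[of "\<lambda>_. - (6 / r\<^sup>2)" y "\<lambda>y. bump 2 a r y * (y - a) $ i" j] d2
      partial_eqI[OF has_derivative_const[of "- (6 / r\<^sup>2)" "at y"], of j]
    by (simp add: p1)
  also have "partial j (\<lambda>y. bump 2 a r y * (y - a) $ i) y
     = bump 2 a r y * (if i = j then 1 else 0) - (4 / r\<^sup>2) * (bump 1 a r y * (y - a) $ j) * (y - a) $ i"
    using partial_scaleR[OF d1, of j] unfolding p2 partial_component real_scaleR_def by simp
  finally have eq: "partial j (partial i (bump 3 a r)) y = - (6 / r\<^sup>2) *
     (bump 2 a r y * (if i = j then 1 else 0) - (4 / r\<^sup>2) * (bump 1 a r y * (y - a) $ j) * (y - a) $ i)" .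
  have "\<bar>bump 1 a r y * (y - a) $ j * (y - a) $ i\<bar> \<le> 1 * r * r"
    unfolding abs_mult using r by (intro mult_mono b c) auto
  then have "(4 / r\<^sup>2) * \<bar>bump 1 a r y * (y - a) $ j * (y - a) $ i\<bar> \<le> (4 / r\<^sup>2) * (1 * r * r)"
    by (intro mult_left_mono) auto
  then have "\<bar>(4 / r\<^sup>2) * (bump 1 a r y * (y - a) $ j) * (y - a) $ i\<bar> \<le> 4"
    using r by (simp add: abs_mult power2_eq_square mult.assoc)
  moreover have "\<bar>bump 2 a r y * (if i = j then 1 else 0)\<bar> \<le> 1" using b[of 2] by auto
  ultimately have "\<bar>bump 2 a r y * (if i = j then 1 else 0) - (4 / r\<^sup>2) * (bump 1 a r y * (y - a) $ j) * (y - a) $ i\<bar> \<le> 5"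
    by linarith
  then have "(6 / r\<^sup>2) * \<bar>bump 2 a r y * (if i = j then 1 else 0) - (4 / r\<^sup>2) * (bump 1 a r y * (y - a) $ j) * (y - a) $ i\<bar>
     \<le> (6 / r\<^sup>2) * 5"
    by (intro mult_left_mono) auto
  then show "\<bar>partial j (partial i (bump 3 a r)) y\<bar> \<le> 30 / r\<^sup>2"
    unfolding eq abs_mult by simp
qed

text \<open>The coefficients and their first derivatives are bounded on the fixed ball of radius
  \<open>R\<close>, so \<open>C\<close> does not depend on \<open>r\<close>. Terms in which a
  derivative falls on a coefficient are only of size 1 / r, and are absorbed because
  \<open>R\<close> is at most 1.\<close>

lemma div_op_bump_bound:
  fixes A :: "'n::finite \<Rightarrow> 'n \<Rightarrow> real^'n \<Rightarrow> real"
  assumes S: "open S" and K: "cball a R \<subseteq> S" and R: "R \<le> 1"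
    and A: "\<And>i j. Ck_on (Suc 0) S (A i j)"
  obtains C where "0 \<le> C" "\<And>r y. 0 < r \<Longrightarrow> r \<le> R \<Longrightarrow> \<bar>div_op A (bump 3 a r) y\<bar> \<le> C / r\<^sup>2"
proof -
  have "\<exists>B. \<forall>y\<in>cball a R. \<bar>h y\<bar> \<le> B" if "continuous_on S h" for h :: "real^'n \<Rightarrow> real"
  proof -
    have "bounded (h ` cball a R)"
      by (intro compact_imp_bounded compact_continuous_image continuous_on_subset[OF that K]) auto
    then show ?thesis by (auto simp: bounded_iff)
  qed
  then have "\<forall>i j. \<exists>B. \<forall>y\<in>cball a R. \<bar>A i j y\<bar> \<le> B" "\<forall>i j. \<exists>B. \<forall>y\<in>cball a R. \<bar>partial j (A i j) y\<bar> \<le> B"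
    using Ck_on_Suc_imp_continuous[OF A] C1_on_continuous_partial[OF A] by blast+
  then obtain B B' where B: "\<And>i j y. y \<in> cball a R \<Longrightarrow> \<bar>A i j y\<bar> \<le> B i j"
    and B': "\<And>i j y. y \<in> cball a R \<Longrightarrow> \<bar>partial j (A i j) y\<bar> \<le> B' i j"
    by metis
  define C where "C = (\<Sum>i\<in>UNIV. \<Sum>j\<in>UNIV. 30 * \<bar>B i j\<bar> + 6 * \<bar>B' i j\<bar>)"
  have C0: "0 \<le> C" unfolding C_def by (intro sum_nonneg) auto
  have "\<bar>div_op A (bump 3 a r) y\<bar> \<le> C / r\<^sup>2" if r: "0 < r" "r \<le> R" for r y
  proof (cases "y \<in> cball a r")
    case True
    then have yR: "y \<in> cball a R" and yS: "y \<in> S" using r K by auto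
    have "\<bar>partial j (\<lambda>z. A i j z * partial i (bump 3 a r) z) y\<bar> \<le> (30 * \<bar>B i j\<bar> + 6 * \<bar>B' i j\<bar>) / r\<^sup>2" for i j
    proof -
      have "partial j (\<lambda>z. A i j z *\<^sub>R partial i (bump 3 a r) z) y
        = A i j y *\<^sub>R partial j (partial i (bump 3 a r)) y + partial j (A i j) y *\<^sub>R partial i (bump 3 a r) y"
        using A[of i j] C2_bump[of a r] yS
        by (intro partial_scaleR) (auto simp: differentiable_on_eq_differentiable_at S)
      moreover have "\<bar>A i j y\<bar> * \<bar>partial j (partial i (bump 3 a r)) y\<bar> \<le> \<bar>B i j\<bar> * (30 / r\<^sup>2)"
        using B[OF yR, of i j] by (intro mult_mono bump_partial_bounds r True) auto
      moreover have "\<bar>partial j (A i j) y\<bar> * \<bar>partial i (bump 3 a r) y\<bar> \<le> \<bar>B' i j\<bar> * (6 / r)"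
        using B'[OF yR, where i=i and j=j] by (intro mult_mono bump_partial_bounds r True) auto
      moreover have "\<bar>B' i j\<bar> * (6 / r) \<le> \<bar>B' i j\<bar> * (6 / r\<^sup>2)"
        using r R by (intro mult_left_mono divide_left_mono) (auto simp: power2_eq_square mult_left_le)
      ultimately show ?thesis
        by (simp add: abs_mult[symmetric] add_divide_distrib mult.commute)
    qed
    then have "\<bar>div_op A (bump 3 a r) y\<bar> \<le> (\<Sum>i\<in>UNIV. \<Sum>j\<in>UNIV. (30 * \<bar>B i j\<bar> + 6 * \<bar>B' i j\<bar>) / r\<^sup>2)"
      unfolding div_op_def by (intro order_trans[OF sum_abs] sum_mono)
    then show ?thesis by (simp add: C_def sum_divide_distrib)
  next
    case False
    then have "div_op A (bump 3 a r) y = 0"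
      by (intro div_op_eq_0[where a = a and r = r] bump_eq_0 r) auto
    then show ?thesis using C0 by simp
  qed
  then show ?thesis using C0 by (intro that)
qed


section \<open>Integration in a chart\<close>

text \<open>One chart, reduced to what integration uses: \<xi> is the coordinate map with inverse
  \<kappa>, and \<open>w\<close> stands for the square root of the determinant of the metric in
  coordinates.\<close>

locale volume_chart =
  fixes \<mu> :: "'a::{t2_space, second_countable_topology} measure"
    and U :: "'a set" and \<xi> :: "'a \<Rightarrow> real^'n::finite" and \<kappa> :: "real^'n \<Rightarrow> 'a"
    and R :: "(real^'n) set" and w :: "real^'n \<Rightarrow> real"
  assumes homeo: "homeomorphism U R \<xi> \<kappa>" and open_R: "open R"
    and sets_\<mu>: "sets \<mu> = sets (restrict_space borel (space \<mu>))" and U_sets: "U \<in> sets \<mu>"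
    and w_cont: "continuous_on R w" and w_pos: "\<And>y. y \<in> R \<Longrightarrow> 0 < w y"
    and volume: "\<And>B. B \<in> sets \<mu> \<Longrightarrow> B \<subseteq> U \<Longrightarrow> emeasure \<mu> B = (\<integral>\<^sup>+y\<in>\<xi> ` B. ennreal (w y) \<partial>lborel)"
begin

lemma U_sub: "U \<subseteq> space \<mu>"
  using U_sets by (rule sets.sets_into_space)

lemma chart_measurable: "\<xi> \<in> measurable (restrict_space \<mu> U) borel"
proof -
  have "sets (restrict_space \<mu> U) = sets (restrict_space (restrict_space borel (space \<mu>)) U)"
    by (intro sets_restrict_space_cong sets_\<mu>)
  also have "\<dots> = sets (restrict_space borel U)"
    using U_sub by (simp add: sets_restrict_restrict_space Int_absorb1)
  finally have "sets (restrict_space \<mu> U) = sets (restrict_space borel U)" .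
  moreover have "\<xi> \<in> measurable (restrict_space borel U) borel"
    using homeo by (intro borel_measurable_continuous_on_restrict) (simp add: homeomorphism_def)
  ultimately show ?thesis by (simp cong: measurable_cong_sets)
qed

lemma weight_measurable: "(\<lambda>y. indicator R y * w y) \<in> borel_measurable borel"
  using borel_measurable_continuous_on_indicator[OF _ w_cont] open_R by simp

lemma preimage_sets: "E \<in> sets borel \<Longrightarrow> \<xi> -` E \<inter> U \<in> sets \<mu>"
  using measurable_sets[OF chart_measurable, of E] U_sets U_sub
  by (auto simp: space_restrict_space sets_restrict_space Int_absorb2)

text \<open>This turns the volume formula for sets into an equality of measures on Euclidean space,
  from which the change of variables for integrals follows by transport. The density is cut off by
  the indicator of \<open>R\<close> since \<open>w\<close> is arbitrary elsewhere.\<close>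

lemma distr_chart: "distr (restrict_space \<mu> U) borel \<xi> = density lborel (\<lambda>y. ennreal (indicator R y * w y))"
proof (rule measure_eqI)
  fix E assume "E \<in> sets (distr (restrict_space \<mu> U) borel \<xi>)"
  then have E: "E \<in> sets borel" by simp
  have img: "\<xi> ` (\<xi> -` E \<inter> U) = R \<inter> E"
    using homeo by (auto simp: homeomorphism_def image_iff)
  have "emeasure (distr (restrict_space \<mu> U) borel \<xi>) E = emeasure (restrict_space \<mu> U) (\<xi> -` E \<inter> U)"
    using U_sub by (simp add: emeasure_distr[OF chart_measurable E] space_restrict_space Int_absorb2)
  also have "\<dots> = emeasure \<mu> (\<xi> -` E \<inter> U)"
    using U_sub U_sets by (intro emeasure_restrict_space) (auto simp: Int_absorb2)
  also have "\<dots> = (\<integral>\<^sup>+y\<in>R \<inter> E. ennreal (w y) \<partial>lborel)"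
    by (simp add: volume[OF preimage_sets[OF E]] img)
  also have "\<dots> = (\<integral>\<^sup>+y. ennreal (indicator R y * w y) * indicator E y \<partial>lborel)"
    by (intro nn_integral_cong) (auto simp: indicator_def)
  also have "\<dots> = emeasure (density lborel (\<lambda>y. ennreal (indicator R y * w y))) E"
    using weight_measurable E by (intro emeasure_density[symmetric]) auto
  finally show "emeasure (distr (restrict_space \<mu> U) borel \<xi>) E
    = emeasure (density lborel (\<lambda>y. ennreal (indicator R y * w y))) E" .
qed simp

section \<open>Change of variables for integrals over a chart\<close>

context
  fixes H :: "real^'n \<Rightarrow> 'b::{banach, second_countable_topology}"
  assumes H: "H \<in> borel_measurable borel"
begin

lemma measurable_chart_lift: "(\<lambda>x. indicator U x *\<^sub>R H (\<xi> x)) \<in> borel_measurable \<mu>"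
  using U_sub U_sets measurable_compose[OF chart_measurable H]
  by (subst (asm) borel_measurable_restrict_space_iff) (auto simp: Int_absorb2)

lemma integrable_chart_iff:
  "integrable \<mu> (\<lambda>x. indicator U x *\<^sub>R H (\<xi> x)) \<longleftrightarrow> integrable lborel (\<lambda>y. (indicator R y * w y) *\<^sub>R H y)"
proof -
  have "integrable \<mu> (\<lambda>x. indicator U x *\<^sub>R H (\<xi> x)) \<longleftrightarrow> integrable (restrict_space \<mu> U) (\<lambda>x. H (\<xi> x))"
    using U_sub U_sets by (subst integrable_restrict_space) (auto simp: Int_absorb2)
  also have "\<dots> \<longleftrightarrow> integrable (distr (restrict_space \<mu> U) borel \<xi>) H"
    by (rule integrable_distr_eq[OF chart_measurable H, symmetric])
  also have "\<dots> \<longleftrightarrow> integrable lborel (\<lambda>y. (indicator R y * w y) *\<^sub>R H y)"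
    unfolding distr_chart using H weight_measurable w_pos
    by (intro integrable_density) (auto simp: indicator_def less_imp_le)
  finally show ?thesis .
qed

lemma integral_chart:
  "(\<integral>x. indicator U x *\<^sub>R H (\<xi> x) \<partial>\<mu>) = (\<integral>y. (indicator R y * w y) *\<^sub>R H y \<partial>lborel)"
proof -
  have "(\<integral>x. indicator U x *\<^sub>R H (\<xi> x) \<partial>\<mu>) = (\<integral>x. H (\<xi> x) \<partial>restrict_space \<mu> U)"
    using U_sub U_sets by (subst integral_restrict_space) (auto simp: Int_absorb2)
  also have "\<dots> = (\<integral>y. H y \<partial>distr (restrict_space \<mu> U) borel \<xi>)"
    by (rule integral_distr[OF chart_measurable H, symmetric])
  also have "\<dots> = (\<integral>y. (indicator R y * w y) *\<^sub>R H y \<partial>lborel)"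
    unfolding distr_chart using H weight_measurable w_pos
    by (intro integral_density) (auto simp: indicator_def less_imp_le)
  finally show ?thesis .
qed

end

lemma emeasure_preimage_le:
  assumes "cball a r \<subseteq> R" "\<And>y. y \<in> cball a r \<Longrightarrow> w y \<le> W" "0 \<le> W"
  shows "emeasure \<mu> (\<xi> -` cball a r \<inter> U) \<le> ennreal (W * measure lborel (cball a r))"
proof -
  have "\<xi> ` (\<xi> -` cball a r \<inter> U) = cball a r \<inter> \<xi> ` U" by blast
  then have img: "\<xi> ` (\<xi> -` cball a r \<inter> U) = cball a r"
    using homeo assms(1) by (auto simp: homeomorphism_def)
  have "emeasure \<mu> (\<xi> -` cball a r \<inter> U) = (\<integral>\<^sup>+y\<in>cball a r. ennreal (w y) \<partial>lborel)"
    by (subst volume) (use img in \<open>auto intro!: preimage_sets\<close>)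
  also have "\<dots> \<le> (\<integral>\<^sup>+y\<in>cball a r. ennreal W \<partial>lborel)"
    by (intro nn_integral_mono) (use assms in \<open>auto simp: indicator_def ennreal_leI\<close>)
  also have "\<dots> = ennreal (W * measure lborel (cball a r))"
    using emeasure_lborel_cball_finite[of a r] assms(3)
    by (simp add: nn_integral_cmult_indicator ennreal_mult emeasure_eq_ennreal_measure top_unique less_top)
  finally show ?thesis .
qed

end

text \<open>On a bump at scale \<open>K/N\<close> with \<open>K\<close> large, the Laplacian costs at most a small multiple of \<open>N\<^sup>2\<close>
  in \<open>L\<^sup>2\<close>, so that most of the spectral mass lies below \<open>N\<close>.\<close>
lemma (in volume_chart) concentrated_functions:
  fixes Ai :: "'n \<Rightarrow> 'n \<Rightarrow> real^'n \<Rightarrow> real"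
  assumes a: "a \<in> R" and A: "\<And>i j. Ck_on (Suc 0) R (Ai i j)"
  obtains K N\<^sub>0 :: real where "0 < K" "0 < N\<^sub>0"
    "\<And>N. N \<ge> N\<^sub>0 \<Longrightarrow> \<exists>r \<Phi> \<Psi>. 0 < r \<and> cball a r \<subseteq> R \<and> \<Phi> \<in> L2 \<mu> \<and> \<Psi> \<in> L2 \<mu> \<and>
       0 < (\<integral>x. (cmod (\<Phi> x))\<^sup>2 \<partial>\<mu>) \<and> 4 * (\<integral>x. (cmod (\<Psi> x))\<^sup>2 \<partial>\<mu>) \<le> N ^ 4 * (\<integral>x. (cmod (\<Phi> x))\<^sup>2 \<partial>\<mu>) \<and>
       (\<exists>B\<in>sets \<mu>. emeasure \<mu> B \<le> ennreal (K / N ^ CARD('n)) \<and> (\<forall>x. x \<notin> B \<longrightarrow> \<Phi> x = 0)) \<and>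
       \<Phi> = (\<lambda>x. indicator U x *\<^sub>R of_real (bump 3 a r (\<xi> x))) \<and>
       \<Psi> = (\<lambda>x. indicator U x *\<^sub>R of_real (div_op Ai (bump 3 a r) (\<xi> x) / w (\<xi> x)))"
proof -
  obtain R0 where R0: "0 < R0" "cball a R0 \<subseteq> R"
    using open_R a open_contains_cball by blast
  define R1 where "R1 = min R0 1"
  have R1: "0 < R1" "R1 \<le> 1" "cball a R1 \<subseteq> R" using R0 by (auto simp: R1_def)
  obtain C where C: "0 \<le> C" "\<And>r y. 0 < r \<Longrightarrow> r \<le> R1 \<Longrightarrow> \<bar>div_op Ai (bump 3 a r) y\<bar> \<le> C / r\<^sup>2"
    by (rule div_op_bump_bound[OF open_R R1(3,2) A]) (rule that)
  have cw: "continuous_on (cball a R1) w" by (rule continuous_on_subset[OF w_cont R1(3)])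
  have ne: "cball a R1 \<noteq> {}" using R1 by auto
  obtain w0 where w0: "0 < w0" "\<And>y. y \<in> cball a R1 \<Longrightarrow> w0 \<le> w y"
    using continuous_attains_inf[OF compact_cball ne cw] w_pos R1(3) by (metis subsetD)
  obtain w1 where w1: "0 < w1" "\<And>y. y \<in> cball a R1 \<Longrightarrow> w y \<le> w1"
    using continuous_attains_sup[OF compact_cball ne cw] w_pos R1(3) by (metis subsetD)
  define V where "V = unit_ball_vol (DIM(real^'n))"
  have V: "0 < V" by (simp add: V_def)
  have vol: "measure lborel (cball a r) = V * r ^ CARD('n)" if "0 \<le> r" for r
    using content_cball[OF that, of a] by (simp add: V_def)
  \<comment> \<open>Comparing \<open>upG\<close> with \<open>lowH\<close> at r = K0 / N, all powers
    of \<open>r\<close> and the volume constant \<open>V\<close> cancel, and the required inequality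
    between the two norms reduces to \<open>D \<le> K0 ^ 4\<close>.\<close>
  define D where "D = 4 * C\<^sup>2 * 2 ^ CARD('n) / (w0\<^sup>2 * (3/4)^6)"
  define K0 where "K0 = 1 + D"
  have D0: "0 \<le> D" by (simp add: D_def)
  have K0: "1 \<le> K0" "D \<le> K0 ^ 4"
  proof -
    show *: "1 \<le> K0" using D0 by (simp add: K0_def)
    have "K0 ^ 1 \<le> K0 ^ 4" by (rule power_increasing) (use * in auto)
    then show "D \<le> K0 ^ 4" by (simp add: K0_def)
  qed
  \<comment> \<open>The supporting ball has radius K0 / N and density at most \<open>w1\<close>,
    which gives volume at most K / N^n. The threshold \<open>N0\<close> keeps this radius below
    \<open>R1\<close>.\<close>
  define K where "K = w1 * V * K0 ^ CARD('n)"
  define N0 where "N0 = K0 / R1"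
  have main: "\<exists>r \<Phi> \<Psi>. 0 < r \<and> cball a r \<subseteq> R \<and> \<Phi> \<in> L2 \<mu> \<and> \<Psi> \<in> L2 \<mu> \<and>
       0 < (\<integral>x. (cmod (\<Phi> x))\<^sup>2 \<partial>\<mu>) \<and> 4 * (\<integral>x. (cmod (\<Psi> x))\<^sup>2 \<partial>\<mu>) \<le> N ^ 4 * (\<integral>x. (cmod (\<Phi> x))\<^sup>2 \<partial>\<mu>) \<and>
       (\<exists>B\<in>sets \<mu>. emeasure \<mu> B \<le> ennreal (K / N ^ CARD('n)) \<and> (\<forall>x. x \<notin> B \<longrightarrow> \<Phi> x = 0)) \<and>
       \<Phi> = (\<lambda>x. indicator U x *\<^sub>R of_real (bump 3 a r (\<xi> x))) \<and>
       \<Psi> = (\<lambda>x. indicator U x *\<^sub>R of_real (div_op Ai (bump 3 a r) (\<xi> x) / w (\<xi> x)))"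
    if N: "N0 \<le> N" for N
  proof -
    define r where "r = K0 / N"
    have Npos: "0 < N" using N K0 R1 by (simp add: N0_def) (smt (verit) divide_pos_pos)
    have r: "0 < r" "r \<le> R1"
      using N K0 R1 Npos by (auto simp: r_def N0_def field_simps)
    have cs: "cball a r \<subseteq> cball a R1" "cball a r \<subseteq> R" using r R1(3) by auto
    let ?b = "bump 3 a r" and ?L = "div_op Ai (bump 3 a r)"
    have b0: "?b y = 0" if "y \<notin> cball a r" for y using bump_eq_0[of 3 r y a] r that by simp
    have L0: "?L y = 0" if "y \<notin> cball a r" for y by (rule div_op_eq_0[OF b0 that])
    have Lc: "continuous_on R ?L" by (rule continuous_on_div_op[OF open_R A C2_bump])
    define H where "H y = complex_of_real (?b y)" for y
    \<comment> \<open>The indicator makes \<open>G\<close> measurable on the whole space, as neither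
      continuity of the numerator nor positivity of \<open>w\<close> is known off \<open>R\<close>.
      On the manifold it is invisible: \<xi> maps \<open>U\<close> into \<open>R\<close>.\<close>
    define G where "G y = complex_of_real (indicator R y * (?L y / w y))" for y
    have Hm: "H \<in> borel_measurable borel"
      unfolding H_def by (intro borel_measurable_continuous_onI continuous_intros continuous_on_bump)
    have Gm: "G \<in> borel_measurable borel"
    proof -
      have "(\<lambda>y. indicator R y *\<^sub>R (?L y / w y)) \<in> borel_measurable borel"
        using open_R w_pos by (intro borel_measurable_continuous_on_indicator continuous_intros Lc w_cont)
         (auto dest: less_imp_neq[OF w_pos])
      moreover have "(of_real :: real \<Rightarrow> complex) \<in> borel_measurable borel"
        by (intro borel_measurable_continuous_onI continuous_intros)
      ultimately show ?thesis
        unfolding G_def[abs_def] real_scaleR_def by (rule measurable_compose)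
    qed
    define \<Phi> where "\<Phi> x = indicator U x *\<^sub>R H (\<xi> x)" for x
    define \<Psi> where "\<Psi> x = indicator U x *\<^sub>R G (\<xi> x)" for x
    have \<Phi>sq: "(cmod (\<Phi> x))\<^sup>2 = indicator U x *\<^sub>R (cmod (H (\<xi> x)))\<^sup>2" for x
      by (simp add: \<Phi>_def indicator_def)
    have \<Psi>sq: "(cmod (\<Psi> x))\<^sup>2 = indicator U x *\<^sub>R (cmod (G (\<xi> x)))\<^sup>2" for x
      by (simp add: \<Psi>_def indicator_def)
    have Hm2: "(\<lambda>y. (cmod (H y))\<^sup>2) \<in> borel_measurable borel"
      and Gm2: "(\<lambda>y. (cmod (G y))\<^sup>2) \<in> borel_measurable borel"
      using Hm Gm by measurable
    have eqH: "(indicator R y * w y) *\<^sub>R (cmod (H y))\<^sup>2 = indicator (cball a r) y *\<^sub>R (w y * (?b y)\<^sup>2)" for y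
      using b0 cs(2) by (auto simp: H_def indicator_def)
    have eqG: "(indicator R y * w y) *\<^sub>R (cmod (G y))\<^sup>2 = indicator (cball a r) y *\<^sub>R ((?L y)\<^sup>2 / w y)" for y
      unfolding G_def norm_of_real power2_abs using L0 cs(2)
      by (auto simp: indicator_def power2_eq_square)
    have iH: "integrable lborel (\<lambda>y. indicator (cball a r) y *\<^sub>R (w y * (?b y)\<^sup>2))"
      using continuous_on_subset[OF w_cont cs(2)] continuous_on_subset[OF continuous_on_bump]
      by (intro borel_integrable_compact continuous_intros) auto
    have iG: "integrable lborel (\<lambda>y. indicator (cball a r) y *\<^sub>R ((?L y)\<^sup>2 / w y))"
      using continuous_on_subset[OF w_cont cs(2)] continuous_on_subset[OF Lc cs(2)] w_pos cs(2)
      by (intro borel_integrable_compact continuous_intros) (force dest: less_imp_neq[OF w_pos])+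
    have nH: "(\<integral>x. (cmod (\<Phi> x))\<^sup>2 \<partial>\<mu>) = (\<integral>y. indicator (cball a r) y *\<^sub>R (w y * (?b y)\<^sup>2) \<partial>lborel)"
      unfolding \<Phi>sq integral_chart[OF Hm2] by (simp only: eqH)
    have nG: "(\<integral>x. (cmod (\<Psi> x))\<^sup>2 \<partial>\<mu>) = (\<integral>y. indicator (cball a r) y *\<^sub>R ((?L y)\<^sup>2 / w y) \<partial>lborel)"
      unfolding \<Psi>sq integral_chart[OF Gm2] by (simp only: eqG)
    have intH: "integrable \<mu> (\<lambda>x. (cmod (\<Phi> x))\<^sup>2)"
      unfolding \<Phi>sq integrable_chart_iff[OF Hm2] by (simp only: eqH iH)
    have intG: "integrable \<mu> (\<lambda>x. (cmod (\<Psi> x))\<^sup>2)"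
      unfolding \<Psi>sq integrable_chart_iff[OF Gm2] by (simp only: eqG iG)
    have ii: "integrable lborel (\<lambda>y. indicator (cball a s) y *\<^sub>R c)" for s and c :: real
      using borel_integrable_compact[OF compact_cball continuous_on_const] .
    have ic: "(\<integral>y. indicator (cball a s) y *\<^sub>R c \<partial>lborel) = c * (V * s ^ CARD('n))" if "0 \<le> s" for s and c :: real
      using vol[OF that] by simp
    \<comment> \<open>Only the half-radius ball is used, where the cubic bump is at least
      (3/4)^3.\<close>
    have lowH: "w0 * (3/4)^6 * (V * (r/2) ^ CARD('n)) \<le> (\<integral>x. (cmod (\<Phi> x))\<^sup>2 \<partial>\<mu>)"
    proof -
      have "indicator (cball a (r/2)) y *\<^sub>R (w0 * (3/4)^6) \<le> indicator (cball a r) y *\<^sub>R (w y * (?b y)\<^sup>2)" for y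
      proof (cases "y \<in> cball a (r/2)")
        case True
        then have y: "y \<in> cball a r" "y \<in> cball a R1" using r by auto
        have "((3/4)^3)\<^sup>2 \<le> (?b y)\<^sup>2" by (intro power_mono bump_ge r True) auto
        then have "w0 * (3/4)^6 \<le> w y * (?b y)\<^sup>2"
          using w0(2)[OF y(2)] w0(1) by (intro mult_mono) auto
        then show ?thesis using True y by simp
      next
        case False
        then show ?thesis using w_pos cs(2) by (auto simp: indicator_def less_imp_le subset_iff)
      qed
      then have "(\<integral>y. indicator (cball a (r/2)) y *\<^sub>R (w0 * (3/4)^6) \<partial>lborel) \<le> (\<integral>x. (cmod (\<Phi> x))\<^sup>2 \<partial>\<mu>)"
        unfolding nH by (intro integral_mono ii iH)
      then show ?thesis using r by (subst (asm) ic) auto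
    qed
    have upG: "(\<integral>x. (cmod (\<Psi> x))\<^sup>2 \<partial>\<mu>) \<le> (C / r\<^sup>2)\<^sup>2 / w0 * (V * r ^ CARD('n))"
    proof -
      have "indicator (cball a r) y *\<^sub>R ((?L y)\<^sup>2 / w y) \<le> indicator (cball a r) y *\<^sub>R ((C / r\<^sup>2)\<^sup>2 / w0)" for y
      proof (cases "y \<in> cball a r")
        case True
        have "\<bar>?L y\<bar>\<^sup>2 \<le> (C / r\<^sup>2)\<^sup>2" by (intro power_mono C(2) r) auto
        then have "(?L y)\<^sup>2 / w y \<le> (C / r\<^sup>2)\<^sup>2 / w0"
          using w0 True cs by (intro frac_le) auto
        then show ?thesis using True by simp
      qed simp
      then have "(\<integral>x. (cmod (\<Psi> x))\<^sup>2 \<partial>\<mu>) \<le> (\<integral>y. indicator (cball a r) y *\<^sub>R ((C / r\<^sup>2)\<^sup>2 / w0) \<partial>lborel)"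
        unfolding nG by (intro integral_mono ii iG)
      then show ?thesis using r by (subst (asm) ic) auto
    qed
    have ratio: "4 * ((C / r\<^sup>2)\<^sup>2 / w0 * (V * r ^ CARD('n))) \<le> N ^ 4 * (w0 * (3/4)^6 * (V * (r/2) ^ CARD('n)))"
    proof -
      have "4 * C\<^sup>2 * 2 ^ CARD('n) = D * (w0\<^sup>2 * (3/4)^6)"
        using w0(1) by (simp add: D_def)
      also have "\<dots> \<le> K0 ^ 4 * (w0\<^sup>2 * (3/4)^6)"
        using K0(2) by (intro mult_right_mono) auto
      also have "K0 = N * r" using Npos by (simp add: r_def)
      finally have "4 * C\<^sup>2 * 2 ^ CARD('n) \<le> (N * r) ^ 4 * (w0\<^sup>2 * (3/4)^6)" .
      then have "4 * C\<^sup>2 * 2 ^ CARD('n) * (V * r ^ CARD('n) / (r ^ 4 * w0 * 2 ^ CARD('n)))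
          \<le> (N * r) ^ 4 * (w0\<^sup>2 * (3/4)^6) * (V * r ^ CARD('n) / (r ^ 4 * w0 * 2 ^ CARD('n)))"
        using V r w0 by (intro mult_right_mono) auto
      then show ?thesis
        using V r w0(1) by (simp add: power_mult_distrib power_divide power2_eq_square[of w0] field_simps flip: power_add power_mult)
    qed
    have pos: "0 < (\<integral>x. (cmod (\<Phi> x))\<^sup>2 \<partial>\<mu>)"
      by (rule less_le_trans[OF _ lowH]) (use w0 V r in auto)
    have comp: "4 * (\<integral>x. (cmod (\<Psi> x))\<^sup>2 \<partial>\<mu>) \<le> N ^ 4 * (\<integral>x. (cmod (\<Phi> x))\<^sup>2 \<partial>\<mu>)"
    proof -
      have "4 * (\<integral>x. (cmod (\<Psi> x))\<^sup>2 \<partial>\<mu>) \<le> 4 * ((C / r\<^sup>2)\<^sup>2 / w0 * (V * r ^ CARD('n)))"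
        using upG by simp
      also note ratio
      also have "N ^ 4 * (w0 * (3/4)^6 * (V * (r/2) ^ CARD('n))) \<le> N ^ 4 * (\<integral>x. (cmod (\<Phi> x))\<^sup>2 \<partial>\<mu>)"
        using lowH by (intro mult_left_mono) auto
      finally show ?thesis .
    qed
    have B: "\<exists>B\<in>sets \<mu>. emeasure \<mu> B \<le> ennreal (K / N ^ CARD('n)) \<and> (\<forall>x. x \<notin> B \<longrightarrow> \<Phi> x = 0)"
    proof (intro bexI conjI allI impI)
      show "\<xi> -` cball a r \<inter> U \<in> sets \<mu>" by (rule preimage_sets) simp
      have "emeasure \<mu> (\<xi> -` cball a r \<inter> U) \<le> ennreal (w1 * measure lborel (cball a r))"
        by (rule emeasure_preimage_le) (use cs w1 in auto)
      also have "w1 * measure lborel (cball a r) = K / N ^ CARD('n)"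
        using r vol[of r] by (simp add: K_def r_def power_divide)
      finally show "emeasure \<mu> (\<xi> -` cball a r \<inter> U) \<le> ennreal (K / N ^ CARD('n))" .
      fix x assume "x \<notin> \<xi> -` cball a r \<inter> U"
      then show "\<Phi> x = 0" using b0 by (auto simp: \<Phi>_def H_def indicator_def)
    qed
    have "\<Phi> \<in> L2 \<mu>" "\<Psi> \<in> L2 \<mu>"
      using measurable_chart_lift[OF Hm] measurable_chart_lift[OF Gm] intH intG
      by (auto simp: L2_def \<Phi>_def[abs_def] \<Psi>_def[abs_def])
    moreover have "\<Psi> = (\<lambda>x. indicator U x *\<^sub>R of_real (?L (\<xi> x) / w (\<xi> x)))"
      using homeo by (auto simp: \<Psi>_def G_def indicator_def homeomorphism_def fun_eq_iff)
    moreover have "\<Phi> = (\<lambda>x. indicator U x *\<^sub>R of_real (?b (\<xi> x)))"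
      by (simp add: \<Phi>_def H_def fun_eq_iff)
    ultimately show ?thesis
      using r(1) cs(2) pos comp B by blast
  qed
  show ?thesis
    by (rule that[OF _ _ main]) (use K0 w1 V R1 in \<open>auto simp: K_def N0_def\<close>)
qed


section \<open>Lower bounds for Lebesgue norms\<close>

text \<open>Convexity: the graph of the power lies above its tangent at \<open>c\<close>. Integrated
  over a set, this pointwise inequality takes the place of Hoelder's inequality.\<close>

lemma powr_tangent_le:
  fixes s c h :: real
  assumes "1 \<le> s" "0 < c" "0 \<le> h"
  shows "s * c powr (s - 1) * h \<le> h powr s + (s - 1) * c powr s"
proof (cases "s = 1")
  case False
  with assms have s: "1 < s" by simp
  define s' where "s' = s / (s - 1)"
  have s': "1 < s'" "1 / s + 1 / s' = 1" "(s - 1) * s' = s" "s / s' = s - 1"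
    using s by (auto simp: s'_def field_simps)
  have "h * c powr (s - 1) \<le> h powr s / s + (c powr (s - 1)) powr s' / s'"
    by (rule Youngs_inequality) (use s s' assms in auto)
  then have "s * (h * c powr (s - 1)) \<le> s * (h powr s / s + (c powr (s - 1)) powr s' / s')"
    using s by (intro mult_left_mono) auto
  also have "\<dots> = h powr s + s / s' * c powr s"
    using s s'(3) by (simp add: distrib_left powr_powr)
  finally show ?thesis unfolding s'(4) by (simp add: mult_ac)
qed (use assms in simp)

lemma ennreal_rpow_mono: "0 \<le> s \<Longrightarrow> x \<le> y \<Longrightarrow> ennreal_rpow x s \<le> ennreal_rpow y s"
  by (auto simp: ennreal_rpow_def top_unique less_top intro!: ennreal_leI powr_mono2 enn2real_mono)

lemma ennreal_rpow_ennreal: "0 \<le> x \<Longrightarrow> ennreal_rpow (ennreal x) s = ennreal (x powr s)"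
  by (simp add: ennreal_rpow_def)

lemma recip_eq: "r \<noteq> \<infinity> \<Longrightarrow> recip r = 1 / enn2real r"
  by (cases r; cases "r = 0") (auto simp: recip_def inverse_ennreal divide_inverse)

lemma recip_top: "recip top = 0"
  by (simp add: recip_def)

text \<open>Hoelder's inequality on \<open>B\<close>, read as a lower bound for the norm: spreading
  the mass \<eta> evenly over a set of measure \<open>b\<close> is the cheapest configuration.
  Having mass at least \<eta> and measure at most \<open>b\<close> only helps.\<close>

lemma Lnorm_average_le:
  fixes h :: "'a \<Rightarrow> real"
  assumes s: "1 \<le> s" and h: "h \<in> borel_measurable M" "\<And>x. 0 \<le> h x"
    and B: "B \<in> sets M" "emeasure M B \<le> ennreal b" "0 < b"
    and \<eta>: "0 < \<eta>" "ennreal \<eta> \<le> (\<integral>\<^sup>+x\<in>B. ennreal (h x) \<partial>M)"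
  shows "ennreal (\<eta> * b powr (recip s - 1)) \<le> Lnorm M s (\<lambda>x. ennreal (h x))"
proof (cases "s = \<infinity>")
  case True
  define z where "z = esssup M (\<lambda>x. ennreal (h x))"
  have "ennreal \<eta> \<le> (\<integral>\<^sup>+x\<in>B. z \<partial>M)"
  proof (rule order_trans[OF \<eta>(2)], rule nn_integral_mono_AE)
    show "AE x in M. ennreal (h x) * indicator B x \<le> z * indicator B x"
      using esssup_AE[of "\<lambda>x. ennreal (h x)" M] by eventually_elim (auto simp: z_def indicator_def)
  qed
  also have "\<dots> = z * emeasure M B" using B by (simp add: nn_integral_cmult_indicator)
  also have "\<dots> \<le> z * ennreal b" by (intro mult_left_mono B) simp
  finally have *: "ennreal \<eta> \<le> z * ennreal b" .
  have "ennreal (\<eta> / b) \<le> z"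
  proof (cases z)
    case (real r)
    then have "\<eta> \<le> r * b" using * B \<eta> by (simp flip: ennreal_mult)
    then show ?thesis using real B by (simp add: field_simps)
  qed simp
  moreover have "b powr (-1) = 1 / b" using B by (simp add: powr_minus divide_inverse)
  ultimately show ?thesis using True by (simp add: Lnorm_def recip_top z_def)
next
  case False
  define \<tau> where "\<tau> = enn2real s"
  have \<tau>: "1 \<le> \<tau>" using s False enn2real_mono[of 1 s] by (simp add: \<tau>_def less_top)
  have rs: "recip s = 1 / \<tau>" using False by (simp add: recip_eq \<tau>_def)
  \<comment> \<open>The mean value, i.e. the constant for which equality holds. Taking the tangent
    there makes c^(\<tau>-1) \<eta> equal to c^\<tau> b, so the two correction terms
    combine.\<close>
  define c where "c = \<eta> / b"
  have c: "0 < c" using \<eta> B by (simp add: c_def)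
  define X where "X = (\<integral>\<^sup>+x. ennreal (h x powr \<tau>) \<partial>M)"
  have "ennreal (c powr \<tau> * b) \<le> X"
  proof (cases X)
    case (real r)
    have "ennreal (\<tau> * c powr (\<tau> - 1)) * ennreal \<eta> \<le> ennreal (\<tau> * c powr (\<tau> - 1)) * (\<integral>\<^sup>+x\<in>B. ennreal (h x) \<partial>M)"
      by (intro mult_left_mono \<eta>) simp
    also have "\<dots> = (\<integral>\<^sup>+x. ennreal (\<tau> * c powr (\<tau> - 1)) * (ennreal (h x) * indicator B x) \<partial>M)"
      using h B by (intro nn_integral_cmult[symmetric]) auto
    also have "\<dots> \<le> (\<integral>\<^sup>+x. ennreal (h x powr \<tau>) + ennreal ((\<tau> - 1) * c powr \<tau>) * indicator B x \<partial>M)"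
    proof (rule nn_integral_mono)
      fix x
      show "ennreal (\<tau> * c powr (\<tau> - 1)) * (ennreal (h x) * indicator B x)
        \<le> ennreal (h x powr \<tau>) + ennreal ((\<tau> - 1) * c powr \<tau>) * indicator B x"
        using powr_tangent_le[OF \<tau> c h(2), of x] \<tau> h(2)
        by (auto simp: indicator_def ennreal_leI simp flip: ennreal_mult ennreal_plus)
    qed
    also have "\<dots> = X + ennreal ((\<tau> - 1) * c powr \<tau>) * emeasure M B"
      using h B by (simp add: nn_integral_add nn_integral_cmult_indicator X_def)
    also have "\<dots> \<le> X + ennreal ((\<tau> - 1) * c powr \<tau>) * ennreal b"
      by (intro add_left_mono mult_left_mono B) simp
    finally have "\<tau> * c powr (\<tau> - 1) * \<eta> \<le> r + (\<tau> - 1) * c powr \<tau> * b"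
      using real \<tau> \<eta> B by (simp flip: ennreal_mult ennreal_plus)
    moreover have "c powr (\<tau> - 1) * \<eta> = c powr \<tau> * b"
      using c B by (simp add: powr_diff c_def field_simps)
    then have "\<tau> * c powr (\<tau> - 1) * \<eta> = \<tau> * c powr \<tau> * b" by (simp only: mult.assoc)
    ultimately have "\<tau> * c powr \<tau> * b \<le> r + (\<tau> - 1) * c powr \<tau> * b" by (simp only:)
    then have "c powr \<tau> * b \<le> r" by (simp add: algebra_simps)
    then show ?thesis using real by (simp add: ennreal_leI)
  qed simp
  then have "ennreal_rpow (ennreal (c powr \<tau> * b)) (1 / \<tau>) \<le> ennreal_rpow X (1 / \<tau>)"
    using \<tau> by (intro ennreal_rpow_mono) auto
  moreover have "(c powr \<tau> * b) powr (1 / \<tau>) = \<eta> * b powr (1 / \<tau> - 1)"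
    using \<eta>(1) B \<tau> by (simp add: powr_mult powr_powr powr_diff c_def)
  moreover have "Lnorm M s (\<lambda>x. ennreal (h x)) = ennreal_rpow X (1 / \<tau>)"
    using False h(2) by (simp add: Lnorm_def rs X_def ennreal_rpow_ennreal flip: \<tau>_def)
  ultimately show ?thesis using B by (simp add: ennreal_rpow_ennreal rs)
qed

text \<open>\<open>H\<close> is an arbitrary function, because nothing is known about measurability
  in time of the norms to which this is applied. Monotonicity of the upper integral and the
  almost-everywhere bound by the essential supremum suffice.\<close>

lemma Lnorm_ge_const:
  assumes I: "I \<in> sets borel" "0 < measure lborel I" and r: "0 < r"
    and H: "\<And>t. t \<in> I \<Longrightarrow> ennreal m \<le> H t" and m: "0 \<le> m"
  shows "ennreal (m * measure lborel I powr recip r) \<le> Lnorm (restrict_space lborel I) r H"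
proof -
  \<comment> \<open>\<open>measure\<close> assigns 0 to sets of infinite measure, so positivity
    forces finiteness.\<close>
  have fin: "emeasure lborel I = ennreal (measure lborel I)"
    using I(2) by (metis emeasure_eq_ennreal_measure less_irrefl measure_def enn2real_top)
  have em: "emeasure (restrict_space lborel I) I = ennreal (measure lborel I)"
    using I by (simp add: emeasure_restrict_space fin)
  show ?thesis
  proof (cases "r = \<infinity>")
    case True
    \<comment> \<open>The almost-everywhere bound must hold at some point of \<open>I\<close>, since
      \<open>I\<close> is not a null set.\<close>
    have "\<exists>t\<in>I. H t \<le> esssup (restrict_space lborel I) H"
    proof (rule ccontr)
      assume *: "\<not> ?thesis"
      have "AE t in restrict_space lborel I. False"
        using esssup_AE[of H "restrict_space lborel I"] AE_space
        by eventually_elim (use * in \<open>auto simp: space_restrict_space\<close>)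
      then have "emeasure (restrict_space lborel I) (space (restrict_space lborel I)) = 0"
        using AE_iff_measurable[of "space (restrict_space lborel I)" "restrict_space lborel I" "\<lambda>_. False"] by simp
      then show False using em I(2) by (simp add: space_restrict_space)
    qed
    then have "ennreal m \<le> esssup (restrict_space lborel I) H" using H by (meson order_trans)
    then show ?thesis using True I(2) by (simp add: Lnorm_def recip_top)
  next
    case False
    define \<tau> where "\<tau> = enn2real r"
    have \<tau>: "0 < \<tau>" using r False by (simp add: \<tau>_def enn2real_positive_iff less_top)
    have rs: "recip r = 1 / \<tau>" using False by (simp add: recip_eq \<tau>_def)
    have "ennreal (m powr \<tau> * measure lborel I) = (\<integral>\<^sup>+t. ennreal (m powr \<tau>) \<partial>restrict_space lborel I)"
      using em by (simp add: space_restrict_space ennreal_mult)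
    also have "\<dots> \<le> (\<integral>\<^sup>+t. ennreal_rpow (H t) \<tau> \<partial>restrict_space lborel I)"
    proof (rule nn_integral_mono)
      fix t assume "t \<in> space (restrict_space lborel I)"
      then have "ennreal_rpow (ennreal m) \<tau> \<le> ennreal_rpow (H t) \<tau>"
        using \<tau> by (intro ennreal_rpow_mono H) (auto simp: space_restrict_space)
      then show "ennreal (m powr \<tau>) \<le> ennreal_rpow (H t) \<tau>" using m by (simp add: ennreal_rpow_ennreal)
    qed
    finally have "ennreal_rpow (ennreal (m powr \<tau> * measure lborel I)) (1 / \<tau>)
        \<le> ennreal_rpow (\<integral>\<^sup>+t. ennreal_rpow (H t) \<tau> \<partial>restrict_space lborel I) (1 / \<tau>)"
      using \<tau> by (intro ennreal_rpow_mono) auto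
    moreover have "(m powr \<tau> * measure lborel I) powr (1 / \<tau>) = m * measure lborel I powr (1 / \<tau>)"
      using m \<tau> I(2) by (simp add: powr_mult powr_powr)
    ultimately show ?thesis using False m
      by (simp add: Lnorm_def rs ennreal_rpow_ennreal flip: \<tau>_def)
  qed
qed

lemma lnorm_ones_le:
  assumes J: "finite J" "J \<noteq> {}" and r: "0 < r"
  shows "lnorm J r (\<lambda>_. 1) \<le> ennreal (real (card J) powr recip r)"
proof (cases "r = \<infinity>")
  case True
  have "esssup (count_space J) (\<lambda>_. 1::ennreal) \<le> 1"
    by (intro esssup_I) auto
  then show ?thesis using True J by (simp add: lnorm_def Lnorm_def recip_top card_gt_0_iff)
next
  case False
  have c: "emeasure (count_space J) J = ennreal (real (card J))"
    using J by (simp add: ennreal_of_nat_eq_real_of_nat)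
  show ?thesis using False
    by (simp add: lnorm_def Lnorm_def c ennreal_rpow_ennreal[of 1, simplified] ennreal_rpow_ennreal)
qed

lemma recip_half: "recip (r / 2) = 2 * recip r"
proof (cases r)
  case (real x)
  then have "r / 2 = ennreal (x / 2)" by (simp add: ennreal_divide_numeral)
  then show ?thesis using real by (simp add: recip_eq)
qed (simp add: recip_top ennreal_top_divide)


section \<open>Orthonormal systems\<close>

lemma L2_measurable: "f \<in> L2 \<mu> \<Longrightarrow> f \<in> borel_measurable \<mu>"
  by (simp add: L2_def)

lemma L2_integrable_mult_cnj:
  assumes "f \<in> L2 \<mu>" "h \<in> L2 \<mu>"
  shows "integrable \<mu> (\<lambda>x. f x * cnj (h x))"
proof (rule Bochner_Integration.integrable_bound)
  show "integrable \<mu> (\<lambda>x. (cmod (f x))\<^sup>2 + (cmod (h x))\<^sup>2)" using assms by (simp add: L2_def)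
  show "(\<lambda>x. f x * cnj (h x)) \<in> borel_measurable \<mu>"
    using assms[THEN L2_measurable] measurable_compose[OF _ borel_measurable_continuous_onI, of h \<mu> cnj]
    by (intro borel_measurable_times) (auto intro: continuous_intros)
  have "cmod (f x) * cmod (h x) \<le> (cmod (f x))\<^sup>2 + (cmod (h x))\<^sup>2" for x
    using sum_squares_bound[of "cmod (f x)" "cmod (h x)"]
      mult_nonneg_nonneg[OF norm_ge_zero[of "f x"] norm_ge_zero[of "h x"]] by linarith
  then show "AE x in \<mu>. norm (f x * cnj (h x)) \<le> norm ((cmod (f x))\<^sup>2 + (cmod (h x))\<^sup>2)"
    by (simp add: norm_mult)
qed

lemma L2_cmult: "f \<in> L2 \<mu> \<Longrightarrow> (\<lambda>x. c * f x) \<in> L2 \<mu>"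
  by (auto simp: L2_def norm_mult power_mult_distrib)

lemma L2_add:
  assumes "f \<in> L2 \<mu>" "h \<in> L2 \<mu>"
  shows "(\<lambda>x. f x + h x) \<in> L2 \<mu>"
proof -
  have "(\<lambda>x. of_real ((cmod (f x + h x))\<^sup>2) :: complex)
     = (\<lambda>x. f x * cnj (f x) + f x * cnj (h x) + (h x * cnj (f x) + h x * cnj (h x)))"
    by (simp add: complex_norm_square algebra_simps del: of_real_power)
  then have "integrable \<mu> (\<lambda>x. of_real ((cmod (f x + h x))\<^sup>2) :: complex)"
    using assms by (simp add: L2_integrable_mult_cnj del: of_real_power)
  then have "integrable \<mu> (\<lambda>x. (cmod (f x + h x))\<^sup>2)"
    by (simp only: complex_of_real_integrable_eq)
  then show ?thesis using borel_measurable_add[OF assms[THEN L2_measurable]] by (simp add: L2_def)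
qed

lemma L2_zero: "(\<lambda>x. 0) \<in> L2 \<mu>"
  by (simp add: L2_def)

lemma L2_diff: "f \<in> L2 \<mu> \<Longrightarrow> h \<in> L2 \<mu> \<Longrightarrow> (\<lambda>x. f x - h x) \<in> L2 \<mu>"
  using L2_add[OF _ L2_cmult[of h \<mu> "-1"], of f] by simp

lemma L2_sum: "(\<And>k. k \<in> F \<Longrightarrow> f k \<in> L2 \<mu>) \<Longrightarrow> (\<lambda>x. \<Sum>k\<in>F. f k x) \<in> L2 \<mu>"
  by (induction F rule: infinite_finite_induct) (auto simp: L2_zero L2_add)

lemma L2_inner_cnj: "L2_inner \<mu> f h = cnj (L2_inner \<mu> h f)"
  unfolding L2_inner_def by (subst Bochner_Integration.integral_cnj[symmetric]) (simp add: mult.commute)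

lemma L2_inner_self: "L2_inner \<mu> f f = of_real (\<integral>x. (cmod (f x))\<^sup>2 \<partial>\<mu>)"
  by (simp only: L2_inner_def complex_norm_square[symmetric] integral_complex_of_real)

lemma L2_inner_cmult_left: "L2_inner \<mu> (\<lambda>x. c * f x) h = c * L2_inner \<mu> f h"
  by (simp add: L2_inner_def mult.assoc)

lemma L2_inner_cmult_right: "L2_inner \<mu> f (\<lambda>x. c * h x) = cnj c * L2_inner \<mu> f h"
  by (subst (1 2) L2_inner_cnj) (simp add: L2_inner_cmult_left)

lemma L2_inner_diff_left:
  "f \<in> L2 \<mu> \<Longrightarrow> h \<in> L2 \<mu> \<Longrightarrow> u \<in> L2 \<mu> \<Longrightarrow>
    L2_inner \<mu> (\<lambda>x. f x - h x) u = L2_inner \<mu> f u - L2_inner \<mu> h u"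
  by (simp add: L2_inner_def left_diff_distrib L2_integrable_mult_cnj)

lemma L2_inner_diff_right:
  "f \<in> L2 \<mu> \<Longrightarrow> h \<in> L2 \<mu> \<Longrightarrow> u \<in> L2 \<mu> \<Longrightarrow>
    L2_inner \<mu> u (\<lambda>x. f x - h x) = L2_inner \<mu> u f - L2_inner \<mu> u h"
  by (simp add: L2_inner_def right_diff_distrib L2_integrable_mult_cnj)

lemma L2_inner_sum_left:
  "(\<And>k. k \<in> F \<Longrightarrow> f k \<in> L2 \<mu>) \<Longrightarrow> u \<in> L2 \<mu> \<Longrightarrow>
    L2_inner \<mu> (\<lambda>x. \<Sum>k\<in>F. f k x) u = (\<Sum>k\<in>F. L2_inner \<mu> (f k) u)"
  by (simp add: L2_inner_def sum_distrib_right L2_integrable_mult_cnj Bochner_Integration.integral_sum)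

lemma L2_inner_sum_right:
  "(\<And>k. k \<in> F \<Longrightarrow> f k \<in> L2 \<mu>) \<Longrightarrow> u \<in> L2 \<mu> \<Longrightarrow>
    L2_inner \<mu> u (\<lambda>x. \<Sum>k\<in>F. f k x) = (\<Sum>k\<in>F. L2_inner \<mu> u (f k))"
  by (simp add: L2_inner_def sum_distrib_left L2_integrable_mult_cnj Bochner_Integration.integral_sum)

lemma L2_inner_combination_left:
  assumes "\<And>k. k \<in> F \<Longrightarrow> e k \<in> L2 \<mu>" "u \<in> L2 \<mu>"
  shows "L2_inner \<mu> (\<lambda>x. \<Sum>k\<in>F. c k * e k x) u = (\<Sum>k\<in>F. c k * L2_inner \<mu> (e k) u)"
  by (subst L2_inner_sum_left) (auto simp: assms L2_cmult L2_inner_cmult_left)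

lemma L2_inner_combination_right:
  assumes "\<And>k. k \<in> F \<Longrightarrow> e k \<in> L2 \<mu>" "u \<in> L2 \<mu>"
  shows "L2_inner \<mu> u (\<lambda>x. \<Sum>k\<in>F. c k * e k x) = (\<Sum>k\<in>F. cnj (c k) * L2_inner \<mu> u (e k))"
  by (subst L2_inner_sum_right) (auto simp: assms L2_cmult L2_inner_cmult_right)

text \<open>Pythagoras. Nonnegativity of the left side yields Bessel's inequality, and its
  convergence to 0 along a basis yields Parseval's identity.\<close>

lemma norm_sq_minus_projection:
  assumes on: "orthonormal_system \<mu> F e" and F: "finite F" and f: "f \<in> L2 \<mu>"
  shows "(\<integral>x. (cmod (f x - (\<Sum>k\<in>F. L2_inner \<mu> f (e k) * e k x)))\<^sup>2 \<partial>\<mu>)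
     = (\<integral>x. (cmod (f x))\<^sup>2 \<partial>\<mu>) - (\<Sum>k\<in>F. (cmod (L2_inner \<mu> f (e k)))\<^sup>2)"
proof -
  let ?c = "\<lambda>k. L2_inner \<mu> f (e k)"
  let ?S = "\<lambda>x. \<Sum>k\<in>F. ?c k * e k x"
  have e: "e k \<in> L2 \<mu>" if "k \<in> F" for k using on that by (simp add: orthonormal_system_def)
  have S: "?S \<in> L2 \<mu>" by (intro L2_sum L2_cmult e)
  have Se: "L2_inner \<mu> ?S (e k) = ?c k" if "k \<in> F" for k
    using on that F by (subst L2_inner_combination_left)
      (auto simp: e orthonormal_system_def if_distrib[of "\<lambda>z. _ * z"] cong: if_cong)
  have "L2_inner \<mu> (\<lambda>x. f x - ?S x) (\<lambda>x. f x - ?S x)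
     = L2_inner \<mu> f f - L2_inner \<mu> f ?S - (L2_inner \<mu> ?S f - L2_inner \<mu> ?S ?S)"
    by (simp add: L2_inner_diff_left L2_inner_diff_right f S L2_diff)
  also have "L2_inner \<mu> ?S ?S = (\<Sum>k\<in>F. cnj (?c k) * ?c k)"
    by (subst L2_inner_combination_right) (auto simp: e S Se)
  also have "L2_inner \<mu> f ?S = (\<Sum>k\<in>F. cnj (?c k) * ?c k)"
    by (subst L2_inner_combination_right) (auto simp: e f)
  also have "L2_inner \<mu> ?S f = (\<Sum>k\<in>F. ?c k * cnj (?c k))"
    by (subst L2_inner_combination_left) (auto simp: e f simp flip: L2_inner_cnj)
  finally have "complex_of_real (\<integral>x. (cmod (f x - ?S x))\<^sup>2 \<partial>\<mu>) =
     of_real ((\<integral>x. (cmod (f x))\<^sup>2 \<partial>\<mu>) - (\<Sum>k\<in>F. (cmod (?c k))\<^sup>2))"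
    unfolding L2_inner_self by (simp add: mult.commute flip: complex_norm_square)
  then show ?thesis by (simp only: of_real_eq_iff)
qed

lemma bessel_inequality:
  assumes "orthonormal_system \<mu> F e" "finite F" "f \<in> L2 \<mu>"
  shows "(\<Sum>k\<in>F. (cmod (L2_inner \<mu> f (e k)))\<^sup>2) \<le> (\<integral>x. (cmod (f x))\<^sup>2 \<partial>\<mu>)"
proof -
  have "0 \<le> (\<integral>x. (cmod (f x - (\<Sum>k\<in>F. L2_inner \<mu> f (e k) * e k x)))\<^sup>2 \<partial>\<mu>)" by simp
  then show ?thesis unfolding norm_sq_minus_projection[OF assms] by simp
qed

text \<open>Bessel's inequality for the system consisting of the single vector \<open>h\<close>,
  normalised; this is why \<open>h\<close> has positive norm.\<close>

lemma L2_cauchy_schwarz: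
  assumes f: "f \<in> L2 \<mu>" and h: "h \<in> L2 \<mu>" and pos: "0 < (\<integral>x. (cmod (h x))\<^sup>2 \<partial>\<mu>)"
  shows "(cmod (L2_inner \<mu> f h))\<^sup>2 \<le> (\<integral>x. (cmod (f x))\<^sup>2 \<partial>\<mu>) * (\<integral>x. (cmod (h x))\<^sup>2 \<partial>\<mu>)"
proof -
  define n where "n = (\<integral>x. (cmod (h x))\<^sup>2 \<partial>\<mu>)"
  define v where "v = (\<lambda>x. of_real (1 / sqrt n) * h x)"
  have s: "complex_of_real (sqrt n) * complex_of_real (sqrt n) = of_real n"
    using pos by (simp flip: of_real_mult add: n_def)
  have "L2_inner \<mu> v v = 1"
    using pos s unfolding v_def L2_inner_cmult_left L2_inner_cmult_right L2_inner_self n_def[symmetric]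
    by (simp add: field_simps n_def[symmetric])
  moreover have "v \<in> L2 \<mu>" unfolding v_def by (rule L2_cmult[OF h])
  ultimately have "orthonormal_system \<mu> {()} (\<lambda>_. v)"
    by (simp add: orthonormal_system_def)
  from bessel_inequality[OF this _ f]
  have "(cmod (L2_inner \<mu> f v))\<^sup>2 \<le> (\<integral>x. (cmod (f x))\<^sup>2 \<partial>\<mu>)" by simp
  moreover have "(cmod (L2_inner \<mu> f v))\<^sup>2 = (cmod (L2_inner \<mu> f h))\<^sup>2 / n"
    using pos unfolding v_def L2_inner_cmult_right
    by (simp add: norm_mult power_mult_distrib norm_divide power_divide n_def[symmetric])
  ultimately show ?thesis using pos by (simp add: n_def field_simps)
qed

section \<open>Fourier coefficients and the propagator\<close>

lemma parseval:
  assumes b: "orthonormal_basis \<mu> e" and f: "f \<in> L2 \<mu>"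
  shows "(\<lambda>n. \<Sum>k<n. (cmod (fourier_coeff \<mu> e f k))\<^sup>2) \<longlonglongrightarrow> (\<integral>x. (cmod (f x))\<^sup>2 \<partial>\<mu>)"
proof -
  have on: "orthonormal_system \<mu> {..<n} e" for n
    using b by (simp add: orthonormal_basis_def orthonormal_system_def)
  have "(\<lambda>n. \<integral>x. (cmod (f x - (\<Sum>k<n. fourier_coeff \<mu> e f k * e k x)))\<^sup>2 \<partial>\<mu>) \<longlonglongrightarrow> 0"
    using b f by (simp add: orthonormal_basis_def L2_sums_def)
  then have "(\<lambda>n. (\<integral>x. (cmod (f x))\<^sup>2 \<partial>\<mu>) - (\<Sum>k<n. (cmod (fourier_coeff \<mu> e f k))\<^sup>2)) \<longlonglongrightarrow> 0"
    unfolding fourier_coeff_def by (subst (asm) norm_sq_minus_projection[OF on _ f]) auto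
  from tendsto_diff[OF tendsto_const[of "\<integral>x. (cmod (f x))\<^sup>2 \<partial>\<mu>"] this] show ?thesis by simp
qed

lemma fourier_coeff_combination:
  assumes on: "orthonormal_system \<mu> UNIV e" and F: "finite F"
  shows "fourier_coeff \<mu> e (\<lambda>x. \<Sum>k\<in>F. c k * e k x) k = (if k \<in> F then c k else 0)"
  unfolding fourier_coeff_def using on F
  by (subst L2_inner_combination_left)
    (auto simp: orthonormal_system_def if_distrib[of "\<lambda>z. _ * z"] cong: if_cong)

text \<open>The propagator is only determined up to null sets, so all information about it is
  extracted through inner products.\<close>
lemma propagator_combination:
  fixes l :: "nat \<Rightarrow> real" and c :: "nat \<Rightarrow> complex" and a t :: real
  assumes on: "orthonormal_system \<mu> UNIV e" and F: "finite F"
    and \<Phi>: "\<Phi> \<in> L2 \<mu>" "0 < (\<integral>x. (cmod (\<Phi> x))\<^sup>2 \<partial>\<mu>)"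
  defines "u \<equiv> propagator \<mu> e l a t (\<lambda>x. \<Sum>k\<in>F. c k * e k x)"
  shows "u \<in> L2 \<mu>"
    and "L2_inner \<mu> u \<Phi> = (\<Sum>k\<in>F. exp (\<i> * of_real (t * l k powr a)) * c k * L2_inner \<mu> (e k) \<Phi>)"
proof -
  define p where "p k = exp (\<i> * of_real (t * l k powr a))" for k
  define G where "G k x = p k * (if k \<in> F then c k else 0) * e k x" for k x
  define s where "s x = (\<Sum>k\<in>F. p k * c k * e k x)" for x
  have e: "e k \<in> L2 \<mu>" for k using on by (simp add: orthonormal_system_def)
  have s: "s \<in> L2 \<mu>" unfolding s_def by (intro L2_sum L2_cmult e)
  obtain n0 where n0: "F \<subseteq> {..<n0}" using F finite_nat_bounded by blast
  have part: "(\<Sum>k<n. G k x) = s x" if "n0 \<le> n" for n x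
    unfolding s_def G_def using n0 that F
    by (intro sum.mono_neutral_cong_right) (auto simp: subset_iff)
  have ut: "u = L2_suminf \<mu> G"
    unfolding u_def propagator_def fourier_coeff_combination[OF on F] G_def p_def ..
  have "L2_sums \<mu> G s"
    unfolding L2_sums_def
  proof (intro conjI allI s)
    show "G k \<in> L2 \<mu>" for k unfolding G_def by (intro L2_cmult e)
    have "eventually (\<lambda>n. (\<integral>x. (cmod (s x - (\<Sum>k<n. G k x)))\<^sup>2 \<partial>\<mu>) = 0) sequentially"
      using eventually_ge_at_top[of n0] by eventually_elim (simp add: part)
    then show "(\<lambda>n. \<integral>x. (cmod (s x - (\<Sum>k<n. G k x)))\<^sup>2 \<partial>\<mu>) \<longlonglongrightarrow> 0"
      by (rule tendsto_eventually)
  qed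
  then have us: "L2_sums \<mu> G u"
    unfolding ut L2_suminf_def by (rule someI[of "L2_sums \<mu> G"])
  then show u: "u \<in> L2 \<mu>" by (simp add: L2_sums_def)
  \<comment> \<open>The partial sums equal \<open>s\<close> from index \<open>n0\<close> on and also
    converge to \<open>u\<close>, so the distance between the two is 0.\<close>
  have "(\<lambda>n. \<integral>x. (cmod (u x - s x))\<^sup>2 \<partial>\<mu>) \<longlonglongrightarrow> 0"
  proof (rule Lim_transform_eventually)
    show "(\<lambda>n. \<integral>x. (cmod (u x - (\<Sum>k<n. G k x)))\<^sup>2 \<partial>\<mu>) \<longlonglongrightarrow> 0"
      using us by (simp add: L2_sums_def)
    show "eventually (\<lambda>n. (\<integral>x. (cmod (u x - (\<Sum>k<n. G k x)))\<^sup>2 \<partial>\<mu>) = (\<integral>x. (cmod (u x - s x))\<^sup>2 \<partial>\<mu>)) sequentially"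
      using eventually_ge_at_top[of n0] by eventually_elim (simp add: part)
  qed
  then have "(\<integral>x. (cmod (u x - s x))\<^sup>2 \<partial>\<mu>) = 0" by (simp add: LIMSEQ_const_iff)
  then have "L2_inner \<mu> (\<lambda>x. u x - s x) \<Phi> = 0"
    using L2_cauchy_schwarz[OF L2_diff[OF u s] \<Phi>] by simp
  then have "L2_inner \<mu> u \<Phi> = L2_inner \<mu> s \<Phi>"
    by (simp add: L2_inner_diff_left u s \<Phi>)
  also have "\<dots> = (\<Sum>k\<in>F. p k * c k * L2_inner \<mu> (e k) \<Phi>)"
    unfolding s_def by (rule L2_inner_combination_left) (auto simp: e \<Phi>)
  finally show "L2_inner \<mu> u \<Phi> = (\<Sum>k\<in>F. exp (\<i> * of_real (t * l k powr a)) * c k * L2_inner \<mu> (e k) \<Phi>)"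
    by (simp add: p_def)
qed

text \<open>Pairing with \<Phi> sees \<open>f\<close> only on \<open>B\<close>. A lower bound for an
  inner product thus becomes a lower bound for the mass of \<open>f\<close> on
  \<open>B\<close>.\<close>

lemma localized_cauchy_schwarz:
  assumes f: "f \<in> L2 \<mu>" and \<Phi>: "\<Phi> \<in> L2 \<mu>" "0 < (\<integral>x. (cmod (\<Phi> x))\<^sup>2 \<partial>\<mu>)"
    and B: "B \<in> sets \<mu>" "\<And>x. x \<notin> B \<Longrightarrow> \<Phi> x = 0"
  shows "(cmod (L2_inner \<mu> f \<Phi>))\<^sup>2 \<le> (\<integral>x. indicator B x * (cmod (f x))\<^sup>2 \<partial>\<mu>) * (\<integral>x. (cmod (\<Phi> x))\<^sup>2 \<partial>\<mu>)"
proof -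
  let ?f = "\<lambda>x. indicator B x * f x"
  have sq: "(cmod (?f x))\<^sup>2 = indicator B x * (cmod (f x))\<^sup>2" for x
    by (simp add: indicator_def)
  have "integrable \<mu> (\<lambda>x. indicator B x * (cmod (f x))\<^sup>2)"
    using f B integrable_real_mult_indicator[of B \<mu> "\<lambda>x. (cmod (f x))\<^sup>2"]
    by (simp add: L2_def mult.commute)
  then have "?f \<in> L2 \<mu>"
    using borel_measurable_times[OF borel_measurable_indicator[OF B(1)] L2_measurable[OF f]]
    unfolding L2_def mem_Collect_eq sq by simp
  moreover have "L2_inner \<mu> ?f \<Phi> = L2_inner \<mu> f \<Phi>"
    unfolding L2_inner_def using B(2) by (intro Bochner_Integration.integral_cong) (auto simp: indicator_def)
  ultimately show ?thesis using L2_cauchy_schwarz[of ?f \<mu> \<Phi>] \<Phi> by (simp add: sq)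
qed

text \<open>Rotating by the reference phase \<omega> puts every term within angle 1 of the positive
  real axis, and 1 < pi/3 makes each real part at least half of the modulus. Hence the factor
  2.\<close>

lemma sum_nearby_phases:
  fixes \<theta> w :: "'k \<Rightarrow> real"
  assumes \<theta>: "\<And>k. k \<in> F \<Longrightarrow> \<bar>\<theta> k - \<omega>\<bar> \<le> 1" and w: "\<And>k. k \<in> F \<Longrightarrow> 0 \<le> w k"
  shows "(\<Sum>k\<in>F. w k) \<le> 2 * cmod (\<Sum>k\<in>F. exp (\<i> * of_real (\<theta> k)) * of_real (w k))"
proof -
  have c: "1 / 2 \<le> cos (\<theta> k - \<omega>)" if "k \<in> F" for k
  proof -
    have "cos (pi / 3) \<le> cos \<bar>\<theta> k - \<omega>\<bar>"
      using \<theta>[OF that] pi_gt3 by (intro cos_monotone_0_pi_le) auto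
    then show ?thesis by (simp add: cos_60)
  qed
  have "(\<Sum>k\<in>F. w k) / 2 = (\<Sum>k\<in>F. 1 / 2 * w k)" by (simp add: sum_divide_distrib)
  also have "\<dots> \<le> (\<Sum>k\<in>F. cos (\<theta> k - \<omega>) * w k)"
    by (intro sum_mono mult_right_mono c w)
  also have "\<dots> = Re (\<Sum>k\<in>F. exp (\<i> * of_real (\<theta> k - \<omega>)) * of_real (w k))"
    by (simp add: Re_exp)
  also have "\<dots> = Re (exp (- (\<i> * of_real \<omega>)) * (\<Sum>k\<in>F. exp (\<i> * of_real (\<theta> k)) * of_real (w k)))"
    by (simp add: sum_distrib_left exp_diff exp_minus right_diff_distrib divide_inverse mult_ac)
  also have "\<dots> \<le> cmod (exp (- (\<i> * of_real \<omega>)) * (\<Sum>k\<in>F. exp (\<i> * of_real (\<theta> k)) * of_real (w k)))"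
    by (rule complex_Re_le_cmod)
  also have "\<dots> = cmod (\<Sum>k\<in>F. exp (\<i> * of_real (\<theta> k)) * of_real (w k))"
    by (simp add: norm_mult)
  finally show ?thesis by simp
qed


section \<open>The orthonormal system of band projections\<close>

lemma dist_le_measure_interval:
  fixes I :: "real set"
  assumes I: "is_interval I" "0 < measure lborel I" and st: "s \<in> I" "t \<in> I"
  shows "\<bar>t - s\<bar> \<le> measure lborel I"
proof -
  have "I \<in> sets borel" by (rule real_interval_borel_measurable) (rule I)
  \<comment> \<open>An unbounded interval would have \<open>measure\<close> 0 by convention,
    contrary to \<open>I(2)\<close>.\<close>
  moreover have "emeasure lborel I \<noteq> \<infinity>"
    using I(2) by (auto simp: measure_def)
  ultimately have fin: "I \<in> fmeasurable lborel" by (intro fmeasurableI) (auto simp: less_top)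
  have "{min s t..max s t} \<subseteq> I"
    using mem_is_interval_1_I[OF I(1), of "min s t" "max s t"] st
    by (auto simp: min_def max_def)
  then have "measure lborel {min s t..max s t} \<le> measure lborel I"
    by (rule measure_mono_fmeasurable) (use fin in auto)
  then show ?thesis by (simp add: min_def max_def split: if_splits)
qed

text \<open>The orthonormal system consists of the normalised projections of \<open>\<Phi>\<close> onto bands of
  frequencies on which \<open>\<lambda>\<^sup>a\<close> varies by less than \<open>1 / \<bar>I\<bar>\<close>, focused at a time \<open>t\<^sub>0\<close> in \<open>I\<close>. During
  \<open>I\<close> the phases in a band stay aligned, so the whole system keeps its mass on the support of \<open>\<Phi>\<close>,
  while it has only \<open>O(N)\<close> members.\<close>
lemma strichartz_concentration_bound:
  fixes l :: "nat \<Rightarrow> real" and a N C \<sigma> b \<kappa> :: real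
  assumes basis: "orthonormal_basis \<mu> e" and l: "\<And>k. 0 \<le> l k" and a: "0 < a"
    and N: "1 \<le> N" and \<kappa>: "0 < \<kappa>" and C: "0 \<le> C"
    and I: "is_interval I" "0 < measure lborel I" "measure lborel I \<le> \<kappa> * N powr (1 - a)"
    and exponents: "2 \<le> p" "2 \<le> q" "0 < \<beta>"
    and est: "orthonormal_strichartz \<mu> e l a p q \<sigma> \<beta> C N I"
    and \<Phi>: "\<Phi> \<in> L2 \<mu>" "0 < (\<integral>x. (cmod (\<Phi> x))\<^sup>2 \<partial>\<mu>)" and \<Psi>: "\<Psi> \<in> L2 \<mu>"
    and energy: "4 * (\<integral>x. (cmod (\<Psi> x))\<^sup>2 \<partial>\<mu>) \<le> N ^ 4 * (\<integral>x. (cmod (\<Phi> x))\<^sup>2 \<partial>\<mu>)"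
    and coeff: "\<And>k. fourier_coeff \<mu> e \<Psi> k = - of_real ((l k)\<^sup>2) * fourier_coeff \<mu> e \<Phi> k"
    and B: "B \<in> sets \<mu>" "emeasure \<mu> B \<le> ennreal b" "0 < b" "\<And>x. x \<notin> B \<Longrightarrow> \<Phi> x = 0"
  shows "1 / 8 * b powr (2 * recip q - 1) \<le> C * N powr \<sigma> * ((\<kappa> + 1) * N) powr recip \<beta>"
proof -
  have on: "orthonormal_system \<mu> UNIV e" using basis by (simp add: orthonormal_basis_def)
  then have eL: "e k \<in> L2 \<mu>" for k by (simp add: orthonormal_system_def)
  define n2 where "n2 = (\<integral>x. (cmod (\<Phi> x))\<^sup>2 \<partial>\<mu>)"
  have n2: "0 < n2" using \<Phi> by (simp add: n2_def)
  define \<phi> where "\<phi> k = fourier_coeff \<mu> e \<Phi> k" for k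
  \<comment> \<open>Mass budget: a finite truncation keeps three quarters, and frequencies above
    \<open>N\<close> hold at most one quarter, which leaves the half claimed in
    \<open>low\<close>.\<close>
  have "3 / 4 * n2 < n2" using n2 by simp
  then have "eventually (\<lambda>n. 3 / 4 * n2 < (\<Sum>k<n. (cmod (\<phi> k))\<^sup>2)) sequentially"
    unfolding \<phi>_def n2_def by (intro order_tendstoD(1)[OF parseval[OF basis \<Phi>(1)]])
  then obtain n where n: "3 / 4 * n2 < (\<Sum>k<n. (cmod (\<phi> k))\<^sup>2)"
    by (auto simp: eventually_sequentially)
  \<comment> \<open>The truncation at \<open>n\<close> makes \<open>F\<close> finite. Dropping zero
    coefficients guarantees that every occupied band has positive mass \<open>A j\<close>, so its
    projection can be normalised.\<close>
  define F where "F = {k\<in>{..<n}. l k \<le> N \<and> \<phi> k \<noteq> 0}"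
  have F: "finite F" by (simp add: F_def)
  have low: "n2 / 2 \<le> (\<Sum>k\<in>F. (cmod (\<phi> k))\<^sup>2)"
  proof -
    define G where "G = {k\<in>{..<n}. N < l k}"
    have "N ^ 4 * (\<Sum>k\<in>G. (cmod (\<phi> k))\<^sup>2) \<le> (\<Sum>k\<in>G. (cmod (fourier_coeff \<mu> e \<Psi> k))\<^sup>2)"
      unfolding sum_distrib_left
    proof (rule sum_mono)
      fix k assume "k \<in> G"
      then have "N ^ 4 \<le> (l k) ^ 4" using N by (intro power_mono) (auto simp: G_def)
      then have "N ^ 4 * (cmod (\<phi> k))\<^sup>2 \<le> (l k) ^ 4 * (cmod (\<phi> k))\<^sup>2"
        by (rule mult_right_mono) simp
      also have "\<dots> = (cmod (fourier_coeff \<mu> e \<Psi> k))\<^sup>2"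
        unfolding coeff by (simp add: \<phi>_def norm_mult norm_power power_mult_distrib flip: power_mult)
      finally show "N ^ 4 * (cmod (\<phi> k))\<^sup>2 \<le> (cmod (fourier_coeff \<mu> e \<Psi> k))\<^sup>2" .
    qed
    also have "\<dots> \<le> (\<integral>x. (cmod (\<Psi> x))\<^sup>2 \<partial>\<mu>)"
      unfolding fourier_coeff_def using on
      by (intro bessel_inequality \<Psi>) (auto simp: orthonormal_system_def G_def)
    also have "\<dots> \<le> N ^ 4 * (n2 / 4)" using energy by (simp add: n2_def)
    finally have high: "(\<Sum>k\<in>G. (cmod (\<phi> k))\<^sup>2) \<le> n2 / 4" using N by simp
    have "(\<Sum>k<n. (cmod (\<phi> k))\<^sup>2) = (\<Sum>k\<in>F \<union> G. (cmod (\<phi> k))\<^sup>2)"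
      by (rule sum.mono_neutral_right) (auto simp: F_def G_def not_le)
    also have "\<dots> = (\<Sum>k\<in>F. (cmod (\<phi> k))\<^sup>2) + (\<Sum>k\<in>G. (cmod (\<phi> k))\<^sup>2)"
      by (rule sum.union_disjoint) (auto simp: F_def G_def)
    finally show ?thesis using n high by simp
  qed
  have F_ne: "F \<noteq> {}" using low n2 by auto
  \<comment> \<open>\<open>X\<close> is an upper bound for |I|, and the bands are cells of width 1 /
    X for the values of \<lambda>^a. Below frequency \<open>N\<close> their indices run from 0 to
    the integer part of \<kappa> N; the one extra index is absorbed using
    \<open>1 \<le> N\<close>.\<close>
  define X where "X = \<kappa> * N powr (1 - a)"
  have X: "0 < X" using \<kappa> N by (simp add: X_def)
  define band where "band k = nat \<lfloor>l k powr a * X\<rfloor>" for k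
  have band: "real (band k) \<le> l k powr a * X" "l k powr a * X < real (band k) + 1" for k
    using X by (auto simp: band_def)
  define J where "J = band ` F"
  have J: "finite J" "J \<noteq> {}" using F F_ne by (auto simp: J_def)
  have cardJ: "real (card J) \<le> (\<kappa> + 1) * N"
  proof -
    have "real (band k) \<le> \<kappa> * N" if "k \<in> F" for k
    proof -
      have "l k powr a * X \<le> N powr a * X"
        using that l a X by (intro mult_right_mono powr_mono2) (auto simp: F_def)
      also have "\<dots> = \<kappa> * N" using N by (simp add: X_def mult.left_commute flip: powr_add)
      finally show ?thesis using band(1)[of k] by linarith
    qed
    then have "J \<subseteq> {..nat \<lfloor>\<kappa> * N\<rfloor>}" by (auto simp: J_def le_nat_floor)
    then have "card J \<le> Suc (nat \<lfloor>\<kappa> * N\<rfloor>)" using card_mono[OF finite_atMost] by fastforce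
    then have "real (card J) \<le> real (nat \<lfloor>\<kappa> * N\<rfloor>) + 1" by linarith
    also have "real (nat \<lfloor>\<kappa> * N\<rfloor>) \<le> \<kappa> * N" using \<kappa> N by simp
    finally show ?thesis using N by (simp add: algebra_simps)
  qed
  define A where "A j = (\<Sum>k\<in>{k\<in>F. band k = j}. (cmod (\<phi> k))\<^sup>2)" for j
  have A: "0 < A j" if "j \<in> J" for j
    unfolding A_def using that F by (intro sum_pos) (auto simp: J_def F_def)
  have sumA: "(\<Sum>j\<in>J. A j) = (\<Sum>k\<in>F. (cmod (\<phi> k))\<^sup>2)"
    unfolding A_def using F J by (intro sum.group) (auto simp: J_def)
  obtain t0 where t0: "t0 \<in> I" using I(2) by fastforce
  \<comment> \<open>Evolving backwards from \<open>t0\<close> makes the coefficients at time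
    \<open>t0\<close> proportional to those of \<Phi>. Different bands involve disjoint sets of
    basis vectors, so orthogonality is automatic.\<close>
  define \<gamma> where "\<gamma> j k = (if band k = j then exp (- (\<i> * of_real (t0 * l k powr a))) * \<phi> k / of_real (sqrt (A j)) else 0)" for j k
  define f where "f j = (\<lambda>x. \<Sum>k\<in>F. \<gamma> j k * e k x)" for j
  have fL: "f j \<in> L2 \<mu>" for j unfolding f_def by (intro L2_sum L2_cmult eL)
  have ef: "L2_inner \<mu> (e k) (f j) = cnj (\<gamma> j k)" if "k \<in> F" for j k
    using fourier_coeff_combination[OF on F, of "\<gamma> j" k] that L2_inner_cnj[of \<mu> "e k" "f j"]
    by (simp add: f_def fourier_coeff_def)
  have ff: "L2_inner \<mu> (f i) (f j) = (\<Sum>k\<in>F. \<gamma> i k * cnj (\<gamma> j k))" for i j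
    unfolding f_def[of i] by (subst L2_inner_combination_left) (auto simp: eL fL ef)
  have "orthonormal_system \<mu> J f"
    unfolding orthonormal_system_def
  proof (intro conjI ballI fL)
    fix i j assume ij: "i \<in> J" "j \<in> J"
    show "L2_inner \<mu> (f i) (f j) = (if i = j then 1 else 0)"
    proof (cases "i = j")
      case True
      have "cmod (\<gamma> j k) = (if band k = j then cmod (\<phi> k) / sqrt (A j) else 0)" for k
        using A[OF ij(2)] by (simp add: \<gamma>_def norm_mult norm_divide norm_exp_eq_Re)
      then have "(cmod (\<gamma> j k))\<^sup>2 = (if band k = j then (cmod (\<phi> k))\<^sup>2 / A j else 0)" for k
        using A[OF ij(2)] by (simp add: power_divide)
      then have "\<gamma> j k * cnj (\<gamma> j k) = (if band k = j then of_real ((cmod (\<phi> k))\<^sup>2 / A j) else 0)" for k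
        unfolding complex_norm_square[symmetric] by simp
      then have "(\<Sum>k\<in>F. \<gamma> j k * cnj (\<gamma> j k)) = (\<Sum>k\<in>F. if band k = j then of_real ((cmod (\<phi> k))\<^sup>2 / A j) else 0)"
        by (simp only:)
      also have "\<dots> = of_real ((\<Sum>k\<in>{k\<in>F. band k = j}. (cmod (\<phi> k))\<^sup>2) / A j)"
        using F by (simp add: sum.inter_filter[symmetric] sum_divide_distrib del: of_real_power)
      also have "\<dots> = 1" using A[OF ij(2)] by (simp flip: A_def)
      finally show ?thesis using True by (simp add: ff)
    next
      case False
      then have "\<gamma> i k * cnj (\<gamma> j k) = 0" for k by (simp add: \<gamma>_def)
      then show ?thesis using False by (simp only: ff sum.neutral_const if_False)
    qed
  qed
  moreover have "\<forall>j\<in>J. {k. fourier_coeff \<mu> e (f j) k \<noteq> 0} \<subseteq> {k. l k \<le> N}"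
    unfolding f_def fourier_coeff_combination[OF on F] by (auto simp: F_def)
  moreover note lnorm = lnorm_ones_le[OF J exponents(3)]
  then have "lnorm J \<beta> (\<lambda>_. 1) < \<infinity>" by (simp add: le_less_trans)
  ultimately have upper: "mixed_norm I \<mu> (p / 2) (q / 2)
      (\<lambda>t x. \<Sum>\<^sub>\<infinity>j\<in>J. 1 * of_real ((cmod (propagator \<mu> e l a t (f j) x))\<^sup>2))
      \<le> ennreal (C * measure lborel I powr (2 * recip p) * N powr \<sigma>) * lnorm J \<beta> (\<lambda>_. 1)"
    using est unfolding orthonormal_strichartz_def by blast
  define m where "m = 1 / 8 * b powr (2 * recip q - 1)"
  have inner: "ennreal m \<le> Lnorm \<mu> (q / 2) (\<lambda>x. ennreal (cmod
      (\<Sum>\<^sub>\<infinity>j\<in>J. 1 * of_real ((cmod (propagator \<mu> e l a t (f j) x))\<^sup>2))))" if t: "t \<in> I" for t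
  proof -
    define u where "u j = propagator \<mu> e l a t (f j)" for j
    note pcomb = propagator_combination[OF on F \<Phi>, of l a t]
    have uL: "u j \<in> L2 \<mu>" for j unfolding u_def f_def by (rule pcomb)
    have e\<Phi>: "L2_inner \<mu> (e k) \<Phi> = cnj (\<phi> k)" for k
      using L2_inner_cnj by (simp add: \<phi>_def fourier_coeff_def)
    \<comment> \<open>The normalisation divides the band sum \<open>?S\<close> by the root of
      \<open>A j\<close>. Aligned phases give |?S| at least A j / 2, so the inner product has
      modulus at least half the root of \<open>A j\<close>.\<close>
    have lower: "A j \<le> 4 * (cmod (L2_inner \<mu> (u j) \<Phi>))\<^sup>2" if j: "j \<in> J" for j
    proof -
      let ?F = "{k\<in>F. band k = j}"
      let ?S = "\<Sum>k\<in>?F. exp (\<i> * of_real ((t - t0) * l k powr a)) * of_real ((cmod (\<phi> k))\<^sup>2)"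
      have phase: "exp (\<i> * of_real (t * l k powr a)) * \<gamma> j k * cnj (\<phi> k) =
          (if band k = j then exp (\<i> * of_real ((t - t0) * l k powr a)) * of_real ((cmod (\<phi> k))\<^sup>2) / of_real (sqrt (A j)) else 0)" for k
      proof -
        have "exp (\<i> * of_real (t * l k powr a)) * exp (- (\<i> * of_real (t0 * l k powr a)))
            = exp (\<i> * of_real ((t - t0) * l k powr a))"
          by (simp add: algebra_simps flip: exp_add)
        then show ?thesis unfolding complex_norm_square \<gamma>_def by (simp add: mult.assoc[symmetric])
      qed
      have "L2_inner \<mu> (u j) \<Phi> = (\<Sum>k\<in>F. exp (\<i> * of_real (t * l k powr a)) * \<gamma> j k * cnj (\<phi> k))"
        unfolding u_def f_def pcomb(2) e\<Phi> ..
      also have "\<dots> = ?S / of_real (sqrt (A j))"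
        unfolding phase using F by (simp add: sum.inter_filter[symmetric] sum_divide_distrib)
      finally have "cmod (L2_inner \<mu> (u j) \<Phi>) = cmod ?S / sqrt (A j)"
        using A[OF j] by (simp add: norm_divide)
      moreover have "A j \<le> 2 * cmod ?S"
        unfolding A_def
      \<comment> \<open>The reference frequency is the lower edge j / X of the band. Frequencies
        differ from it by at most 1 / X and times from \<open>t0\<close> by at most
        \<open>X\<close>, so the phases differ by at most 1.\<close>
      proof (rule sum_nearby_phases[where \<omega> = "(t - t0) * (real j / X)"])
        fix k assume k: "k \<in> ?F"
        have "\<bar>l k powr a - real j / X\<bar> \<le> 1 / X"
        proof -
          have "\<bar>l k powr a * X - real j\<bar> \<le> 1" using band[of k] k by auto
          moreover have "l k powr a - real j / X = (l k powr a * X - real j) / X"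
            using X by (simp add: field_simps)
          ultimately show ?thesis using X by (simp add: divide_right_mono)
        qed
        moreover have "\<bar>t - t0\<bar> \<le> X"
          using dist_le_measure_interval[OF I(1,2) t0 t] I(3) by (simp add: X_def)
        ultimately have "\<bar>t - t0\<bar> * \<bar>l k powr a - real j / X\<bar> \<le> X * (1 / X)"
          using X by (intro mult_mono) auto
        moreover have "X * (1 / X) = 1" using X by simp
        ultimately show "\<bar>(t - t0) * l k powr a - (t - t0) * (real j / X)\<bar> \<le> 1"
          unfolding right_diff_distrib[symmetric] abs_mult by linarith
      qed simp
      ultimately have "A j \<le> 2 * (cmod (L2_inner \<mu> (u j) \<Phi>) * sqrt (A j))"
        using A[OF j] by simp
      then have "sqrt (A j) * sqrt (A j) \<le> (2 * cmod (L2_inner \<mu> (u j) \<Phi>)) * sqrt (A j)"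
        using A[OF j] by simp
      then have "sqrt (A j) \<le> 2 * cmod (L2_inner \<mu> (u j) \<Phi>)"
        using A[OF j] by (simp only: mult_le_cancel_right) (simp add: not_less)
      then have "(sqrt (A j))\<^sup>2 \<le> (2 * cmod (L2_inner \<mu> (u j) \<Phi>))\<^sup>2"
        using A[OF j] by (intro power_mono) auto
      then show ?thesis using A[OF j] by (simp add: power_mult_distrib)
    qed
    define h where "h x = (\<Sum>j\<in>J. (cmod (u j x))\<^sup>2)" for x
    have int: "integrable \<mu> (\<lambda>x. indicator B x * (cmod (u j x))\<^sup>2)" for j
      using uL[of j] B(1) integrable_real_mult_indicator[of B \<mu> "\<lambda>x. (cmod (u j x))\<^sup>2"]
      by (simp add: L2_def mult.commute)
    have inth: "integrable \<mu> (\<lambda>x. indicator B x * h x)"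
      unfolding h_def sum_distrib_left by (intro Bochner_Integration.integrable_sum int)
    \<comment> \<open>Summing \<open>lower\<close> over the bands recovers half of \<open>n2\<close>
      from \<open>low\<close>, reduced by the factor 4. Cauchy-Schwarz contributes a factor
      \<open>n2\<close> on the other side, so the density has mass at least 1/8 on \<open>B\<close>
      whatever the size of \<Phi>.\<close>
    have "n2 / 8 \<le> (\<Sum>j\<in>J. A j / 4)"
      using low by (simp add: sumA flip: sum_divide_distrib)
    also have "\<dots> \<le> (\<Sum>j\<in>J. (\<integral>x. indicator B x * (cmod (u j x))\<^sup>2 \<partial>\<mu>) * n2)"
    proof (rule sum_mono)
      fix j assume "j \<in> J"
      then have "A j / 4 \<le> (cmod (L2_inner \<mu> (u j) \<Phi>))\<^sup>2" using lower by fastforce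
      also have "\<dots> \<le> (\<integral>x. indicator B x * (cmod (u j x))\<^sup>2 \<partial>\<mu>) * n2"
        unfolding n2_def by (rule localized_cauchy_schwarz[OF uL \<Phi> B(1,4)])
      finally show "A j / 4 \<le> (\<integral>x. indicator B x * (cmod (u j x))\<^sup>2 \<partial>\<mu>) * n2" .
    qed
    also have "\<dots> = (\<integral>x. indicator B x * h x \<partial>\<mu>) * n2"
      unfolding h_def sum_distrib_left sum_distrib_right[symmetric]
      by (subst Bochner_Integration.integral_sum) (auto intro: int)
    finally have "1 / 8 \<le> (\<integral>x. indicator B x * h x \<partial>\<mu>)" using n2 by simp
    moreover have h0: "0 \<le> h x" for x by (simp add: h_def sum_nonneg)
    have "(\<integral>\<^sup>+x\<in>B. ennreal (h x) \<partial>\<mu>) = (\<integral>\<^sup>+x. ennreal (indicator B x * h x) \<partial>\<mu>)"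
      by (intro nn_integral_cong) (simp add: indicator_def)
    then have "(\<integral>\<^sup>+x\<in>B. ennreal (h x) \<partial>\<mu>) = ennreal (\<integral>x. indicator B x * h x \<partial>\<mu>)"
      using nn_integral_eq_integral[OF inth] h0 by simp
    ultimately have mass: "ennreal (1 / 8) \<le> (\<integral>\<^sup>+x\<in>B. ennreal (h x) \<partial>\<mu>)"
      by (simp only: ennreal_leI)
    have hm: "h \<in> borel_measurable \<mu>"
    proof -
      note [measurable] = L2_measurable[OF uL]
      show ?thesis unfolding h_def[abs_def] by measurable
    qed
    have "1 \<le> q / 2"
    proof -
      have "2 / 2 \<le> q / 2" by (rule divide_right_mono_ennreal[OF exponents(2)])
      then show ?thesis by (simp add: ennreal_divide_self)
    qed
    from Lnorm_average_le[OF this hm h0 B(1,2,3) _ mass]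
    have "ennreal m \<le> Lnorm \<mu> (q / 2) (\<lambda>x. ennreal (h x))"
      by (simp add: recip_half m_def)
    moreover have "cmod (\<Sum>\<^sub>\<infinity>j\<in>J. 1 * of_real ((cmod (propagator \<mu> e l a t (f j) x))\<^sup>2)) = h x" for x
    proof -
      have "(\<Sum>\<^sub>\<infinity>j\<in>J. 1 * of_real ((cmod (propagator \<mu> e l a t (f j) x))\<^sup>2)) = complex_of_real (h x)"
        using J by (simp add: h_def u_def)
      then show ?thesis using h0[of x] by (simp only: norm_of_real abs_of_nonneg)
    qed
    ultimately show ?thesis by (simp only:)
  qed
  let ?L = "measure lborel I powr (2 * recip p)"
  have "0 < p" by (rule less_le_trans[OF _ exponents(1)]) simp
  then have "0 < p / 2" by (simp add: ennreal_zero_less_divide)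
  then have "ennreal (m * ?L) \<le> mixed_norm I \<mu> (p / 2) (q / 2)
      (\<lambda>t x. \<Sum>\<^sub>\<infinity>j\<in>J. 1 * of_real ((cmod (propagator \<mu> e l a t (f j) x))\<^sup>2))"
    unfolding mixed_norm_def
    using Lnorm_ge_const[OF real_interval_borel_measurable[OF I(1)] I(2) _ inner, of "p / 2"]
    by (simp add: recip_half m_def)
  also have "\<dots> \<le> ennreal (C * ?L * N powr \<sigma>) * lnorm J \<beta> (\<lambda>_. 1)" by (rule upper)
  also have "\<dots> \<le> ennreal (C * ?L * N powr \<sigma>) * ennreal (real (card J) powr recip \<beta>)"
    by (intro mult_left_mono lnorm) simp
  also have "\<dots> = ennreal (C * ?L * N powr \<sigma> * real (card J) powr recip \<beta>)"
    using C by (simp add: ennreal_mult)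
  finally have "m * ?L \<le> C * ?L * N powr \<sigma> * real (card J) powr recip \<beta>"
    using C by (subst (asm) ennreal_le_iff) auto
  \<comment> \<open>The time factor, the only trace of \<open>p\<close>, cancels because
    \<open>I\<close> has positive length.\<close>
  then have "m * ?L \<le> (C * N powr \<sigma> * real (card J) powr recip \<beta>) * ?L" by (simp add: mult_ac)
  then have "m \<le> C * N powr \<sigma> * real (card J) powr recip \<beta>" using I(2) by simp
  also have "\<dots> \<le> C * N powr \<sigma> * ((\<kappa> + 1) * N) powr recip \<beta>"
    using C cardJ by (intro mult_left_mono powr_mono2) (auto simp: recip_def)
  finally show ?thesis by (simp add: m_def)
qed


section \<open>The Laplacian of a bump\<close>

text \<open>Green's formula in the chart. Dividing by \<open>w\<close> compensates the volume
  density, so both integrations by parts take place with respect to Lebesgue measure, and the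
  equation for \<open>u\<close> brings \<open>w\<close> back.\<close>

lemma (in volume_chart) L2_inner_div_op:
  fixes Ai :: "'n \<Rightarrow> 'n \<Rightarrow> real^'n \<Rightarrow> real" and c :: real and u :: "'a \<Rightarrow> complex"
  assumes A: "\<And>i j. Ck_on (Suc 0) R (Ai i j)" and u: "Ck_on (Suc (Suc 0)) R (u \<circ> \<kappa>)"
    and eqn: "\<And>y. y \<in> R \<Longrightarrow>
      (\<Sum>i\<in>UNIV. partial i (\<lambda>z. \<Sum>j\<in>UNIV. Ai i j z *\<^sub>R partial j (u \<circ> \<kappa>) z) y) = (c * w y) *\<^sub>R u (\<kappa> y)"
    and r: "0 < r" "cball a r \<subseteq> R"
  shows "L2_inner \<mu> (\<lambda>x. indicator U x *\<^sub>R of_real (div_op Ai (bump 3 a r) (\<xi> x) / w (\<xi> x))) u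
    = of_real c * L2_inner \<mu> (\<lambda>x. indicator U x *\<^sub>R of_real (bump 3 a r (\<xi> x))) u"
proof -
  let ?b = "bump 3 a r" and ?L = "div_op Ai (bump 3 a r)"
  have b0: "?b y = 0" if "y \<notin> cball a r" for y using bump_eq_0[of 3 r y a] r that by simp
  have L0: "?L y = 0" if "y \<notin> cball a r" for y by (rule div_op_eq_0[OF b0 that])
  have out: "?b y = 0" "?L y = 0" if "y \<notin> R" for y
    using b0[of y] L0[of y] subsetD[OF r(2), of y] that by blast+
  have uc: "continuous_on R (\<lambda>y. u (\<kappa> y))"
    using Ck_on_Suc_imp_continuous[OF u] by (simp add: o_def)
  \<comment> \<open>The inner product conjugates \<open>u\<close>, whereas the differential equation
    is for \<open>u\<close> itself. As \<open>h\<close> and \<open>w\<close> are real, the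
    conjugation can be moved outside the integral.\<close>
  have key: "L2_inner \<mu> (\<lambda>x. indicator U x *\<^sub>R of_real (h (\<xi> x))) u = cnj (\<integral>y. (w y * h y) *\<^sub>R u (\<kappa> y) \<partial>lborel)"
    if h: "continuous_on R h" "\<And>y. y \<notin> R \<Longrightarrow> h y = 0" for h :: "real^'n \<Rightarrow> real"
  proof -
    define H where "H y = indicator R y *\<^sub>R (of_real (h y) * cnj (u (\<kappa> y)))" for y
    have Hm: "H \<in> borel_measurable borel"
      unfolding H_def using open_R
      by (intro borel_measurable_continuous_on_indicator continuous_intros h uc) auto
    have "L2_inner \<mu> (\<lambda>x. indicator U x *\<^sub>R of_real (h (\<xi> x))) u = (\<integral>x. indicator U x *\<^sub>R H (\<xi> x) \<partial>\<mu>)"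
      unfolding L2_inner_def using homeo
      by (intro Bochner_Integration.integral_cong) (auto simp: H_def indicator_def homeomorphism_def)
    also have "\<dots> = (\<integral>y. (indicator R y * w y) *\<^sub>R H y \<partial>lborel)" by (rule integral_chart[OF Hm])
    also have "\<dots> = (\<integral>y. cnj ((w y * h y) *\<^sub>R u (\<kappa> y)) \<partial>lborel)"
      using h(2) by (intro Bochner_Integration.integral_cong) (auto simp: H_def indicator_def scaleR_conv_of_real)
    finally show ?thesis by (simp only: Bochner_Integration.integral_cnj)
  qed
  have Lc: "continuous_on R ?L" by (rule continuous_on_div_op[OF open_R A C2_bump])
  have "L2_inner \<mu> (\<lambda>x. indicator U x *\<^sub>R of_real (?L (\<xi> x) / w (\<xi> x))) u
      = cnj (\<integral>y. (w y * (?L y / w y)) *\<^sub>R u (\<kappa> y) \<partial>lborel)"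
  proof (rule key)
    show "continuous_on R (\<lambda>y. ?L y / w y)"
      by (intro continuous_intros Lc w_cont) (auto dest: w_pos)
    show "?L y / w y = 0" if "y \<notin> R" for y
      using out that by simp
  qed
  also have "(\<integral>y. (w y * (?L y / w y)) *\<^sub>R u (\<kappa> y) \<partial>lborel) = (\<integral>y. ?L y *\<^sub>R (u \<circ> \<kappa>) y \<partial>lborel)"
  proof (rule Bochner_Integration.integral_cong[OF refl])
    fix y
    show "(w y * (?L y / w y)) *\<^sub>R u (\<kappa> y) = ?L y *\<^sub>R (u \<circ> \<kappa>) y"
      using w_pos[of y] out(2)[of y] by (cases "y \<in> R") auto
  qed
  also have "\<dots> = (\<integral>y. ?b y *\<^sub>R (\<Sum>i\<in>UNIV. partial i (\<lambda>z. \<Sum>j\<in>UNIV. Ai i j z *\<^sub>R partial j (u \<circ> \<kappa>) z) y) \<partial>lborel)"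
    by (rule integral_by_parts_twice[OF open_R r(2) C2_bump b0 A u, symmetric])
  also have "\<dots> = (\<integral>y. c *\<^sub>R ((w y * ?b y) *\<^sub>R u (\<kappa> y)) \<partial>lborel)"
  proof (rule Bochner_Integration.integral_cong[OF refl])
    fix y
    show "?b y *\<^sub>R (\<Sum>i\<in>UNIV. partial i (\<lambda>z. \<Sum>j\<in>UNIV. Ai i j z *\<^sub>R partial j (u \<circ> \<kappa>) z) y)
        = c *\<^sub>R ((w y * ?b y) *\<^sub>R u (\<kappa> y))"
    proof (cases "y \<in> R")
      case True
      then show ?thesis by (simp add: eqn mult_ac)
    next
      case False
      then show ?thesis by (simp add: out)
    qed
  qed
  also have "\<dots> = of_real c * (\<integral>y. (w y * ?b y) *\<^sub>R u (\<kappa> y) \<partial>lborel)"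
    by (simp add: scaleR_conv_of_real)
  also have "cnj \<dots> = of_real c * L2_inner \<mu> (\<lambda>x. indicator U x *\<^sub>R of_real (?b (\<xi> x))) u"
  proof (subst key)
    show "continuous_on R ?b" by (rule continuous_on_subset[OF continuous_on_bump]) simp
    show "?b y = 0" if "y \<notin> R" for y
      using out that by simp
  qed simp
  finally show ?thesis .
qed

section \<open>Riemannian charts and eigenfunctions\<close>

lemma riemannian_chart:
  fixes M :: "'a::{t2_space, second_countable_topology} set" and A :: "('a, 'n::finite) chart set"
  assumes man: "compact_riemannian_manifold M A g \<mu>" and c: "c \<in> A"
  defines "w \<equiv> \<lambda>y. sqrt (det (g c (chart_inv c y)))"
  shows "volume_chart \<mu> (fst c) (snd c) (chart_inv c) (chart_range c) w"
    and "Ck_on (Suc 0) (chart_range c) (\<lambda>y. w y * matrix_inv (g c (chart_inv c y)) $ i $ j)"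
proof -
  have at: "openin (top_of_set M) (fst c)" "open (chart_range c)"
    "homeomorphism (fst c) (chart_range c) (snd c) (chart_inv c)"
    using man c by (auto simp: compact_riemannian_manifold_def smooth_atlas_def)
  have inv: "chart_inv c y \<in> fst c" if "y \<in> chart_range c" for y
    using at(3) that by (auto simp: homeomorphism_def)
  have "smooth_on (chart_range c) (\<lambda>y. g c (chart_inv c y))"
    using man c by (simp add: compact_riemannian_manifold_def riemannian_metric_def)
  then have "Ck_on (Suc 0) (chart_range c) (\<lambda>y. g c (chart_inv c y))"
    unfolding smooth_on_def by blast
  then have G: "Ck_on (Suc 0) (chart_range c) (\<lambda>y. g c (chart_inv c y) $ i $ j)" for i j
    by (intro C1_on_bounded_linear[where L = "\<lambda>X. X $ i $ j", OF _ at(2)]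
        bounded_linear_compose[OF bounded_linear_vec_nth bounded_linear_vec_nth])
  have pos: "0 < det (g c (chart_inv c y))" if "y \<in> chart_range c" for y
    using man c inv[OF that]
    by (intro det_pos_of_pos_def) (simp add: compact_riemannian_manifold_def riemannian_metric_def)
  have w: "Ck_on (Suc 0) (chart_range c) w"
    unfolding w_def by (intro C1_on_sqrt C1_on_det at G pos)
  show "Ck_on (Suc 0) (chart_range c) (\<lambda>y. w y * matrix_inv (g c (chart_inv c y)) $ i $ j)"
    by (intro C1_on_mult C1_on_matrix_inv w at G) (use pos in force)
  have sets: "sets \<mu> = sets (restrict_space borel M)"
    and vol: "\<And>B. B \<in> sets \<mu> \<Longrightarrow> B \<subseteq> fst c \<Longrightarrow> emeasure \<mu> B = (\<integral>\<^sup>+y\<in>snd c ` B. ennreal (w y) \<partial>lborel)"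
    using man c by (auto simp: compact_riemannian_manifold_def riemannian_volume_def w_def)
  have space: "space \<mu> = M"
    using sets_eq_imp_space_eq[OF sets] by (simp add: space_restrict_space)
  obtain T where T: "open T" "fst c = M \<inter> T" using at(1) unfolding openin_open by blast
  have "fst c \<in> sets \<mu>"
    unfolding sets sets_restrict_space T(2) by (rule imageI) (rule borel_open[OF T(1)])
  then show "volume_chart \<mu> (fst c) (snd c) (chart_inv c) (chart_range c) w"
    using at sets vol pos Ck_on_Suc_imp_continuous[OF w]
    by unfold_locales (auto simp: space w_def)
qed

text \<open>Multiplying the eigenvalue equation by \<open>- w\<close> clears the factor 1 / w of the
  coordinate Laplacian. The result is the equation required in \<open>L2_inner_div_op\<close>, with
  constant -\<omega>^2.\<close>

lemma eigenfunction_divergence_form: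
  assumes man: "compact_riemannian_manifold M A g \<mu>" and c: "c \<in> A"
    and u: "sqrt_laplace_eigenfunction A g \<omega> u" and y: "y \<in> chart_range c"
  defines "w \<equiv> \<lambda>y. sqrt (det (g c (chart_inv c y)))"
  shows "(\<Sum>i\<in>UNIV. partial i (\<lambda>z. \<Sum>j\<in>UNIV. (w z * matrix_inv (g c (chart_inv c z)) $ i $ j)
      *\<^sub>R partial j (u \<circ> chart_inv c) z) y) = (- (\<omega>\<^sup>2) * w y) *\<^sub>R u (chart_inv c y)"
    (is "?S = _")
proof -
  interpret volume_chart \<mu> "fst c" "snd c" "chart_inv c" "chart_range c" w
    unfolding w_def by (rule riemannian_chart[OF man c])
  have x: "chart_inv c y \<in> fst c" and sx: "snd c (chart_inv c y) = y"
    using homeo y by (auto simp: homeomorphism_def)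
  have "- laplace_beltrami g c u (chart_inv c y) = of_real (\<omega>\<^sup>2) * u (chart_inv c y)"
    using u c x by (simp add: sqrt_laplace_eigenfunction_def)
  then have eq: "- ((1 / w y) *\<^sub>R ?S) = of_real (\<omega>\<^sup>2) * u (chart_inv c y)"
    by (simp only: laplace_beltrami_def Let_def sx w_def)
  have "S = - w y *\<^sub>R (- ((1 / w y) *\<^sub>R S))" for S :: complex
    using w_pos[OF y] by simp
  from this[of ?S, unfolded eq] show ?thesis
    by (simp add: scaleR_conv_of_real mult_ac)
qed

lemma exponent_le_of_powr_le:
  fixes c C s t :: real
  assumes c: "0 < c" and le: "\<And>n. n\<^sub>0 \<le> n \<Longrightarrow> c * real n powr s \<le> C * real n powr t"
  shows "s \<le> t"
proof (rule ccontr)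
  assume "\<not> s \<le> t"
  then have d: "0 < s - t" by simp
  \<comment> \<open>Chosen so that \<open>c * Y\<close> exceeds \<open>C\<close>: once n^(s-t)
    reaches \<open>Y\<close>, the assumed inequality at \<open>n\<close> fails.\<close>
  define Y where "Y = \<bar>C\<bar> / c + 1"
  have Y: "0 < Y" using c by (simp add: Y_def add_nonneg_pos)
  define n where "n = max n\<^sub>0 (max 1 (nat \<lceil>Y powr (1 / (s - t))\<rceil>))"
  have n: "n\<^sub>0 \<le> n" "1 \<le> n" "Y powr (1 / (s - t)) \<le> real n"
    unfolding n_def by linarith+
  have "Y = (Y powr (1 / (s - t))) powr (s - t)" using d Y by (simp add: powr_powr)
  also have "\<dots> \<le> real n powr (s - t)" using n d by (intro powr_mono2) auto
  finally have "c * Y * real n powr t \<le> c * real n powr (s - t) * real n powr t"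
    using c by (intro mult_right_mono mult_left_mono) auto
  also have "\<dots> = c * real n powr s" using n by (simp add: mult.assoc flip: powr_add)
  also have "\<dots> \<le> C * real n powr t" by (rule le[OF n(1)])
  finally have "c * Y \<le> C" using n by simp
  moreover have "c * Y = \<bar>C\<bar> + c" using c by (simp add: Y_def field_simps)
  ultimately show False using c by linarith
qed


section \<open>The necessary condition\<close>

theorem mainTheorem18:
  fixes M :: "'a::{t2_space, second_countable_topology} set"
    and A :: "('a, 'n::finite) chart set"
    and g :: "('a, 'n) chart \<Rightarrow> 'a \<Rightarrow> real^'n^'n"
    and \<mu> :: "'a measure"
    and e :: "nat \<Rightarrow> 'a \<Rightarrow> complex"
    and l :: "nat \<Rightarrow> real"
    and \<alpha> \<sigma> :: real
    and p q \<beta> :: ennreal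
    and I :: "nat \<Rightarrow> real set"
    and d :: nat
  assumes dimension: "d = CARD('n)"
    and manifold: "compact_riemannian_manifold M A g \<mu>"
    and basis: "laplace_eigenbasis A g \<mu> e l"
    and alpha: "0 < \<alpha>" "\<alpha> \<le> 1"
    and exponents: "2 \<le> p" "2 \<le> q" "0 < \<beta>"
    and intervals: "\<And>N. 10 \<le> N \<Longrightarrow> is_interval (I N)"
    and lengths: "\<exists>K>0. \<forall>N\<ge>10. real N powr (1 - \<alpha>) / K \<le> measure lborel (I N) \<and>
                    measure lborel (I N) \<le> K * real N powr (1 - \<alpha>)"
    and estimate: "\<exists>C>0. \<forall>N\<ge>10. orthonormal_strichartz \<mu> e l \<alpha> p q \<sigma> \<beta> C (real N) (I N)"
  shows "recip \<beta> \<ge> d - 2 * d * recip q - \<sigma> \<and>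
    (recip p = d / 2 * (1 / 2 - recip q) \<longrightarrow>
       (recip \<beta> \<ge> d - 2 * d * recip q - \<sigma> \<longleftrightarrow> recip \<beta> \<ge> 4 * recip p - \<sigma>)) \<and>
    (d \<ge> 2 \<and> recip p = (real d - 1) / 2 * (1 / 2 - recip q) \<longrightarrow>
       (recip \<beta> \<ge> d - 2 * d * recip q - \<sigma> \<longleftrightarrow>
        recip \<beta> \<ge> d / (real d - 1) * (4 * recip p) - \<sigma>))"
proof -
  obtain C where C: "0 < C" and est: "\<And>N. 10 \<le> N \<Longrightarrow> orthonormal_strichartz \<mu> e l \<alpha> p q \<sigma> \<beta> C (real N) (I N)"
    using estimate by auto
  obtain \<kappa> where \<kappa>: "0 < \<kappa>" and len: "\<And>N. 10 \<le> N \<Longrightarrow> real N powr (1 - \<alpha>) / \<kappa> \<le> measure lborel (I N)"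
    "\<And>N. 10 \<le> N \<Longrightarrow> measure lborel (I N) \<le> \<kappa> * real N powr (1 - \<alpha>)"
    using lengths by auto
  have onb: "orthonormal_basis \<mu> e" and eig: "\<And>k. sqrt_laplace_eigenfunction A g (l k) (e k)"
    using basis by (auto simp: laplace_eigenbasis_def)
  have l: "0 \<le> l k" for k using eig by (auto simp: sqrt_laplace_eigenfunction_def)
  have sp: "space \<mu> = M"
    using manifold sets_eq_imp_space_eq[of \<mu> "restrict_space borel M"]
    by (simp add: compact_riemannian_manifold_def riemannian_volume_def space_restrict_space)
  \<comment> \<open>On an empty manifold every integral is 0, but the basis vector
    \<open>e 0\<close> has norm 1.\<close>
  have "M \<noteq> {}"
  proof
    assume "M = {}"
    then have "L2_inner \<mu> (e 0) (e 0) = (\<integral>x. 0 \<partial>\<mu>)"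
      unfolding L2_inner_def by (intro Bochner_Integration.integral_cong) (auto simp: sp)
    then show False using onb by (simp add: orthonormal_basis_def orthonormal_system_def)
  qed
  then obtain c x where c: "c \<in> A" and x: "x \<in> fst c"
    using manifold by (fastforce simp: compact_riemannian_manifold_def smooth_atlas_def)
  define w where "w = (\<lambda>y. sqrt (det (g c (chart_inv c y))))"
  define Ai where "Ai i j y = w y * matrix_inv (g c (chart_inv c y)) $ i $ j" for i j y
  interpret volume_chart \<mu> "fst c" "snd c" "chart_inv c" "chart_range c" w
    unfolding w_def by (rule riemannian_chart[OF manifold c])
  have Ai: "Ck_on (Suc 0) (chart_range c) (Ai i j)" for i j
    using riemannian_chart(2)[OF manifold c, of i j] by (simp only: Ai_def[abs_def] w_def)
  define a where "a = snd c x"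
  have a: "a \<in> chart_range c" using x by (auto simp: a_def chart_range_def)
  have coeff: "L2_inner \<mu> (\<lambda>x. indicator (fst c) x *\<^sub>R of_real (div_op Ai (bump 3 a r) (snd c x) / w (snd c x))) (e k)
      = of_real (- (l k)\<^sup>2) * L2_inner \<mu> (\<lambda>x. indicator (fst c) x *\<^sub>R of_real (bump 3 a r (snd c x))) (e k)"
    if "0 < r" "cball a r \<subseteq> chart_range c" for r k
  proof (rule L2_inner_div_op[OF Ai _ _ that])
    have "smooth_on (chart_range c) (e k \<circ> chart_inv c)"
      using eig[of k] c by (simp add: sqrt_laplace_eigenfunction_def smooth_function_def)
    then show "Ck_on (Suc (Suc 0)) (chart_range c) (e k \<circ> chart_inv c)"
      unfolding smooth_on_def by blast
    show "(\<Sum>i\<in>UNIV. partial i (\<lambda>z. \<Sum>j\<in>UNIV. Ai i j z *\<^sub>R partial j (e k \<circ> chart_inv c) z) y)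
        = (- (l k)\<^sup>2 * w y) *\<^sub>R e k (chart_inv c y)" if "y \<in> chart_range c" for y
      using eigenfunction_divergence_form[OF manifold c eig that] by (simp only: Ai_def w_def)
  qed
  obtain K N0 where K: "0 < K" "0 < N0" and conc: "\<And>N. N \<ge> N0 \<Longrightarrow> \<exists>r \<Phi> \<Psi>. 0 < r \<and> cball a r \<subseteq> chart_range c \<and>
       \<Phi> \<in> L2 \<mu> \<and> \<Psi> \<in> L2 \<mu> \<and> 0 < (\<integral>x. (cmod (\<Phi> x))\<^sup>2 \<partial>\<mu>) \<and>
       4 * (\<integral>x. (cmod (\<Psi> x))\<^sup>2 \<partial>\<mu>) \<le> N ^ 4 * (\<integral>x. (cmod (\<Phi> x))\<^sup>2 \<partial>\<mu>) \<and>
       (\<exists>B\<in>sets \<mu>. emeasure \<mu> B \<le> ennreal (K / N ^ CARD('n)) \<and> (\<forall>x. x \<notin> B \<longrightarrow> \<Phi> x = 0)) \<and>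
       \<Phi> = (\<lambda>x. indicator (fst c) x *\<^sub>R of_real (bump 3 a r (snd c x))) \<and>
       \<Psi> = (\<lambda>x. indicator (fst c) x *\<^sub>R of_real (div_op Ai (bump 3 a r) (snd c x) / w (snd c x)))"
    by (rule concentrated_functions[OF a Ai]) (rule that)
  \<comment> \<open>With b = K / N^d the factor b^(2/q - 1) supplies N^(d - 2d/q), and the number of
    bands supplies N^(1/\<beta>). All other factors are independent of \<open>N\<close>, so only the
    exponents remain to be compared.\<close>
  have bound: "1 / 8 * K powr (2 * recip q - 1) * real N powr (d - 2 * d * recip q)
      \<le> C * (\<kappa> + 1) powr recip \<beta> * real N powr (\<sigma> + recip \<beta>)" if N: "max 10 (nat \<lceil>N0\<rceil>) \<le> N" for N
  proof -
    have N10: "10 \<le> N" and NN0: "N0 \<le> real N" using N by linarith+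
    obtain r \<Phi> \<Psi> B where r: "0 < r" "cball a r \<subseteq> chart_range c"
      and \<Phi>: "\<Phi> \<in> L2 \<mu>" "0 < (\<integral>x. (cmod (\<Phi> x))\<^sup>2 \<partial>\<mu>)" and \<Psi>: "\<Psi> \<in> L2 \<mu>"
      and en: "4 * (\<integral>x. (cmod (\<Psi> x))\<^sup>2 \<partial>\<mu>) \<le> real N ^ 4 * (\<integral>x. (cmod (\<Phi> x))\<^sup>2 \<partial>\<mu>)"
      and B: "B \<in> sets \<mu>" "emeasure \<mu> B \<le> ennreal (K / real N ^ CARD('n))" "\<And>x. x \<notin> B \<Longrightarrow> \<Phi> x = 0"
      and eqs: "\<Phi> = (\<lambda>x. indicator (fst c) x *\<^sub>R of_real (bump 3 a r (snd c x)))"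
        "\<Psi> = (\<lambda>x. indicator (fst c) x *\<^sub>R of_real (div_op Ai (bump 3 a r) (snd c x) / w (snd c x)))"
      using conc[OF NN0] by blast
    have fc: "fourier_coeff \<mu> e \<Psi> k = - of_real ((l k)\<^sup>2) * fourier_coeff \<mu> e \<Phi> k" for k
      unfolding fourier_coeff_def eqs by (simp only: coeff[OF r] of_real_minus)
    have "0 < real N powr (1 - \<alpha>) / \<kappa>" using N10 \<kappa> by simp
    then have pos: "0 < measure lborel (I N)" using len(1)[OF N10] by linarith
    have N1: "1 \<le> real N" and b0: "0 < K / real N ^ CARD('n)" using N10 K by auto
    have "1 / 8 * (K / real N ^ CARD('n)) powr (2 * recip q - 1)
        \<le> C * real N powr \<sigma> * ((\<kappa> + 1) * real N) powr recip \<beta>"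
      by (rule strichartz_concentration_bound[OF onb l alpha(1) N1 \<kappa> less_imp_le[OF C]
            intervals[OF N10] pos len(2)[OF N10] exponents est[OF N10] \<Phi> \<Psi> en fc B(1,2) b0 B(3)])
    moreover have "(K / real N ^ CARD('n)) powr (2 * recip q - 1)
        = K powr (2 * recip q - 1) * real N powr (d - 2 * d * recip q)"
    proof -
      have "(K / real N ^ CARD('n)) = K * real N powr (- real d)"
        using N1 by (simp add: dimension powr_minus powr_realpow divide_inverse)
      then show ?thesis using K N1 by (simp add: powr_mult powr_powr algebra_simps)
    qed
    moreover have "((\<kappa> + 1) * real N) powr recip \<beta> = (\<kappa> + 1) powr recip \<beta> * real N powr recip \<beta>"
      using \<kappa> by (simp add: powr_mult)
    ultimately show ?thesis by (simp add: powr_add mult_ac)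
  qed
  have "d - 2 * d * recip q \<le> \<sigma> + recip \<beta>"
    by (rule exponent_le_of_powr_le[OF _ bound]; (assumption | use K in simp))
  then have main: "recip \<beta> \<ge> d - 2 * d * recip q - \<sigma>" by simp
  show ?thesis
  proof (intro conjI impI)
    show "recip \<beta> \<ge> d - 2 * d * recip q - \<sigma>" by (rule main)
  next
    assume "recip p = d / 2 * (1 / 2 - recip q)"
    then have "4 * recip p = d - 2 * d * recip q" by (simp add: algebra_simps)
    then show "recip \<beta> \<ge> d - 2 * d * recip q - \<sigma> \<longleftrightarrow> recip \<beta> \<ge> 4 * recip p - \<sigma>" by simp
  next
    assume "d \<ge> 2 \<and> recip p = (real d - 1) / 2 * (1 / 2 - recip q)"
    \<comment> \<open>The hypothesis \<open>d \<ge> 2\<close> enters here: it allows cancelling the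
      factor d - 1.\<close>
    then have "4 * recip p = (real d - 1) * (1 - 2 * recip q)" and "real d - 1 \<noteq> 0"
      by (auto simp: field_simps)
    then have "d / (real d - 1) * (4 * recip p) = d * (1 - 2 * recip q)" by simp
    then have "d / (real d - 1) * (4 * recip p) = d - 2 * d * recip q" by (simp add: algebra_simps)
    then show "recip \<beta> \<ge> d - 2 * d * recip q - \<sigma> \<longleftrightarrow> recip \<beta> \<ge> d / (real d - 1) * (4 * recip p) - \<sigma>" by simp
  qed
qed

end
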